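(* (1) For every formula $A$ of the language $\mathcal{L}$, with free variables $x_1,\dots,x_n$, $$\mathsf{IQC}\vdash A \quad\text{iff}\quad \mathsf{Q^\circ S4.t}\vdash \forall x_1\cdots\forall x_n\, A^t .$$ (2) For every sentence $A$ of $\mathcal{L}$ (formula without free variables), $$\mathsf{IQC}\vdash A \quad\text{iff}\quad \mathsf{Q^\circ S4.t}\vdash A^t .$$
   Context: **Language $\mathcal{L}$.** Countably many individual variables $x,y,\dots$; for each $n\ge 0$ countably many $n$-ary predicate symbols; connectives $\bot,\wedge,\vee,\to$; quantifiers $\forall,\exists$. There are no constants, function symbols or equality. Formulas are defined as usual. If no free occurrence of $x$ in $A$ lies in the scope of $\forall y$ or $\exists y$, then $A(y/x)$ denotes the result of replacing all free occurrences of $x$ in $A$ by $y$ (so $A(y/x)=A$ if $x$ is not free in $A$); $A(y/x)$ is used only under this proviso. **$\mathsf{IQC}$** is the least set of formulas of $\mathcal{L}$ containing all substitution instances of theorems of intuitionistic propositional calculus $\mathsf{IPC}$, all instances of the schemes - $\forall x A\to A(y/x)$; - $A(y/x)\to\exists x A$; - $\forall x(A\to B)\to(A\to\forall x B)$ with $x$ not free in $A$; - $\forall x(A\to B)\to(\exists x A\to B)$ with $x$ not free in $B$; and closed under Modus Ponens (from $A$ and $A\to B$ infer $B$) and Generalization (from $A$ infer $\forall x A$). **Propositional tense logic $\mathsf{S4.t}$.** Modalities $\Box_F,\Box_P$; $\Diamond_F=\neg\Box_F\neg$, $\Diamond_P=\neg\Box_P\neg$. $\mathsf{S4.t}$ is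 the least set of propositional tense formulas containing all substitution instances of the (classical) $\mathsf{S4}$-axioms for $\Box_F$ and for $\Box_P$ (classical tautologies, and for each $\Box\in\{\Box_F,\Box_P\}$: $\Box(A\to B)\to(\Box A\to\Box B)$, $\Box A\to A$, $\Box A\to\Box\Box A$), the schemes $A\to\Box_P\Diamond_F A$ and $A\to\Box_F\Diamond_P A$, and closed under Modus Ponens and the rules: from $A$ infer $\Box_F A$; from $A$ infer $\Box_P A$. **Predicate tense logic $\mathsf{Q^\circ S4.t}$.** $\mathcal{L}_T$ is the extension of $\mathcal{L}$ with $\Box_F,\Box_P$. The base is classical: $\bot,\to,\forall,\Box_F,\Box_P$ are primitive and $\neg,\wedge,\vee,\leftrightarrow,\exists,\Diamond_F,\Diamond_P$ are the usual classical abbreviations. For a formula $A$ of $\mathcal{L}_T$ in which no free occurrence of $x$ lies in the scope of $\forall y$ or $\exists y$, $A(y/x)$ denotes the result of replacing all free occurrences of $x$ in $A$ by $y$ (so $A(y/x)=A$ if $x$ is not free in $A$), and $A(y/x)$ is used only under this proviso. $\mathsf{Q^\circ S4.t}$ is the least set of formulas of $\mathcal{L}_T$ containing all substitution instances of theorems of $\mathsf{S4.t}$, all instances of the schemes - $\forall y(\forall x A\to A(y/x))$; - $\forall x(A\to B)\to(\forall x A\to\forall x B)$; - $\forall x\forall y A\leftrightarrow\forall y\forall x A$; - $A\to\forall x A$ with $x$ not free in $A$; - $\forall x A\to A$ with $x$ not free in $A$; - $\Box_F\forall x A\to\forall x\Box_F A$; and closed under Modus Ponens, Generalization, and the two necessitation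 rules (from $A$ infer $\Box_F A$; from $A$ infer $\Box_P A$). $\vdash$ denotes membership in the logic. **Translation $(\cdot)^t$ from $\mathcal{L}$-formulas to $\mathcal{L}_T$-formulas:** $\bot^t=\bot$; $P(x_1,\dots,x_n)^t=\Box_F P(x_1,\dots,x_n)$; $(A\wedge B)^t=A^t\wedge B^t$; $(A\vee B)^t=A^t\vee B^t$; $(A\to B)^t=\Box_F(A^t\to B^t)$; $(\forall x A)^t=\Box_F\forall x A^t$; $(\exists x A)^t=\Diamond_P\exists x A^t$. *)

theory Defs
  imports Main
begin

section \<open>Propositional logic\<close>

datatype pfm = PVar nat | PBot | PAnd pfm pfm | POr pfm pfm | PImp pfm pfm

inductive_set IPC :: "pfm set" where
  IPC_K: "PImp a (PImp b a) \<in> IPC"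
| IPC_S: "PImp (PImp a (PImp b c)) (PImp (PImp a b) (PImp a c)) \<in> IPC"
| IPC_AndE1: "PImp (PAnd a b) a \<in> IPC"
| IPC_AndE2: "PImp (PAnd a b) b \<in> IPC"
| IPC_AndI: "PImp a (PImp b (PAnd a b)) \<in> IPC"
| IPC_OrI1: "PImp a (POr a b) \<in> IPC"
| IPC_OrI2: "PImp b (POr a b) \<in> IPC"
| IPC_OrE: "PImp (PImp a c) (PImp (PImp b c) (PImp (POr a b) c)) \<in> IPC"
| IPC_BotE: "PImp PBot a \<in> IPC"
| IPC_MP: "a \<in> IPC \<Longrightarrow> PImp a b \<in> IPC \<Longrightarrow> b \<in> IPC"

primrec peval :: "(nat \<Rightarrow> bool) \<Rightarrow> pfm \<Rightarrow> bool" where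
  "peval v (PVar i) = v i"
| "peval v PBot = False"
| "peval v (PAnd a b) = (peval v a \<and> peval v b)"
| "peval v (POr a b) = (peval v a \<or> peval v b)"
| "peval v (PImp a b) = (peval v a \<longrightarrow> peval v b)"

definition classical_taut :: "pfm \<Rightarrow> bool" where
  "classical_taut p \<longleftrightarrow> (\<forall>v. peval v p)"


section \<open>The propositional tense logic S4.t\<close>

datatype tfm = TVar nat | TBot | TImp tfm tfm | TBoxF tfm | TBoxP tfm

abbreviation TNot :: "tfm \<Rightarrow> tfm" where "TNot a \<equiv> TImp a TBot"
abbreviation TOr :: "tfm \<Rightarrow> tfm \<Rightarrow> tfm" where "TOr a b \<equiv> TImp (TNot a) b"
abbreviation TAnd :: "tfm \<Rightarrow> tfm \<Rightarrow> tfm" where "TAnd a b \<equiv> TNot (TImp a (TNot b))"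
abbreviation TDiaF :: "tfm \<Rightarrow> tfm" where "TDiaF a \<equiv> TNot (TBoxF (TNot a))"
abbreviation TDiaP :: "tfm \<Rightarrow> tfm" where "TDiaP a \<equiv> TNot (TBoxP (TNot a))"

primrec pfm_to_tfm :: "(nat \<Rightarrow> tfm) \<Rightarrow> pfm \<Rightarrow> tfm" where
  "pfm_to_tfm s (PVar i) = s i"
| "pfm_to_tfm s PBot = TBot"
| "pfm_to_tfm s (PAnd a b) = TAnd (pfm_to_tfm s a) (pfm_to_tfm s b)"
| "pfm_to_tfm s (POr a b) = TOr (pfm_to_tfm s a) (pfm_to_tfm s b)"
| "pfm_to_tfm s (PImp a b) = TImp (pfm_to_tfm s a) (pfm_to_tfm s b)"

inductive_set S4t :: "tfm set" where
  S4t_taut: "classical_taut p \<Longrightarrow> pfm_to_tfm s p \<in> S4t"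
| S4t_KF: "TImp (TBoxF (TImp a b)) (TImp (TBoxF a) (TBoxF b)) \<in> S4t"
| S4t_TF: "TImp (TBoxF a) a \<in> S4t"
| S4t_4F: "TImp (TBoxF a) (TBoxF (TBoxF a)) \<in> S4t"
| S4t_KP: "TImp (TBoxP (TImp a b)) (TImp (TBoxP a) (TBoxP b)) \<in> S4t"
| S4t_TP: "TImp (TBoxP a) a \<in> S4t"
| S4t_4P: "TImp (TBoxP a) (TBoxP (TBoxP a)) \<in> S4t"
| S4t_PF: "TImp a (TBoxP (TDiaF a)) \<in> S4t"
| S4t_FP: "TImp a (TBoxF (TDiaP a)) \<in> S4t"
| S4t_MP: "a \<in> S4t \<Longrightarrow> TImp a b \<in> S4t \<Longrightarrow> b \<in> S4t"
| S4t_NecF: "a \<in> S4t \<Longrightarrow> TBoxF a \<in> S4t"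
| S4t_NecP: "a \<in> S4t \<Longrightarrow> TBoxP a \<in> S4t"


section \<open>Intuitionistic predicate logic\<close>

type_synonym var = nat

text \<open>The predicate symbol of \<open>IPred k xs\<close> is the \<open>k\<close>-th symbol of arity \<open>length xs\<close>:
  symbols are pairs of an index and an arity, so atoms with equal \<open>k\<close> but argument lists of
  different length use different symbols. The same convention is used for \<open>QPred\<close> below.\<close>

datatype ifm =
    IBot
  | IPred nat "var list"
  | IAnd ifm ifm
  | IOr ifm ifm
  | IImp ifm ifm
  | IAll var ifm
  | IEx var ifm

primrec ifv :: "ifm \<Rightarrow> var set" where
  "ifv IBot = {}"
| "ifv (IPred k xs) = set xs"
| "ifv (IAnd A B) = ifv A \<union> ifv B"
| "ifv (IOr A B) = ifv A \<union> ifv B"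
| "ifv (IImp A B) = ifv A \<union> ifv B"
| "ifv (IAll z A) = ifv A - {z}"
| "ifv (IEx z A) = ifv A - {z}"

text \<open>\<open>isubst y x A\<close> is \<open>A(y/x)\<close>, without renaming of bound variables. It is only used under the
  proviso \<open>ifree_for y x A\<close>: no free occurrence of \<open>x\<close> in \<open>A\<close> lies in the scope of a quantifier
  on \<open>y\<close>.\<close>

primrec isubst :: "var \<Rightarrow> var \<Rightarrow> ifm \<Rightarrow> ifm" where
  "isubst y x IBot = IBot"
| "isubst y x (IPred k xs) = IPred k (map (\<lambda>z. if z = x then y else z) xs)"
| "isubst y x (IAnd A B) = IAnd (isubst y x A) (isubst y x B)"
| "isubst y x (IOr A B) = IOr (isubst y x A) (isubst y x B)"
| "isubst y x (IImp A B) = IImp (isubst y x A) (isubst y x B)"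
| "isubst y x (IAll z A) = IAll z (if z = x then A else isubst y x A)"
| "isubst y x (IEx z A) = IEx z (if z = x then A else isubst y x A)"

primrec ifree_for :: "var \<Rightarrow> var \<Rightarrow> ifm \<Rightarrow> bool" where
  "ifree_for y x IBot = True"
| "ifree_for y x (IPred k xs) = True"
| "ifree_for y x (IAnd A B) = (ifree_for y x A \<and> ifree_for y x B)"
| "ifree_for y x (IOr A B) = (ifree_for y x A \<and> ifree_for y x B)"
| "ifree_for y x (IImp A B) = (ifree_for y x A \<and> ifree_for y x B)"
| "ifree_for y x (IAll z A) = (x \<notin> ifv (IAll z A) \<or> (z \<noteq> y \<and> ifree_for y x A))"
| "ifree_for y x (IEx z A) = (x \<notin> ifv (IEx z A) \<or> (z \<noteq> y \<and> ifree_for y x A))"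

primrec pfm_to_ifm :: "(nat \<Rightarrow> ifm) \<Rightarrow> pfm \<Rightarrow> ifm" where
  "pfm_to_ifm s (PVar i) = s i"
| "pfm_to_ifm s PBot = IBot"
| "pfm_to_ifm s (PAnd a b) = IAnd (pfm_to_ifm s a) (pfm_to_ifm s b)"
| "pfm_to_ifm s (POr a b) = IOr (pfm_to_ifm s a) (pfm_to_ifm s b)"
| "pfm_to_ifm s (PImp a b) = IImp (pfm_to_ifm s a) (pfm_to_ifm s b)"

inductive_set IQC :: "ifm set" where
  IQC_IPC: "p \<in> IPC \<Longrightarrow> pfm_to_ifm s p \<in> IQC"
| IQC_AllE: "ifree_for y x A \<Longrightarrow> IImp (IAll x A) (isubst y x A) \<in> IQC"
| IQC_ExI: "ifree_for y x A \<Longrightarrow> IImp (isubst y x A) (IEx x A) \<in> IQC"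
| IQC_AllI: "x \<notin> ifv A \<Longrightarrow> IImp (IAll x (IImp A B)) (IImp A (IAll x B)) \<in> IQC"
| IQC_ExE: "x \<notin> ifv B \<Longrightarrow> IImp (IAll x (IImp A B)) (IImp (IEx x A) B) \<in> IQC"
| IQC_MP: "A \<in> IQC \<Longrightarrow> IImp A B \<in> IQC \<Longrightarrow> B \<in> IQC"
| IQC_Gen: "A \<in> IQC \<Longrightarrow> IAll x A \<in> IQC"


section \<open>Predicate tense logic\<close>

datatype qfm =
    QBot
  | QPred nat "var list"
  | QImp qfm qfm
  | QAll var qfm
  | QBoxF qfm
  | QBoxP qfm

abbreviation QNot :: "qfm \<Rightarrow> qfm" where "QNot A \<equiv> QImp A QBot"
abbreviation QOr :: "qfm \<Rightarrow> qfm \<Rightarrow> qfm" where "QOr A B \<equiv> QImp (QNot A) B"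
abbreviation QAnd :: "qfm \<Rightarrow> qfm \<Rightarrow> qfm" where "QAnd A B \<equiv> QNot (QImp A (QNot B))"
abbreviation QIff :: "qfm \<Rightarrow> qfm \<Rightarrow> qfm" where "QIff A B \<equiv> QAnd (QImp A B) (QImp B A)"
abbreviation QEx :: "var \<Rightarrow> qfm \<Rightarrow> qfm" where "QEx x A \<equiv> QNot (QAll x (QNot A))"
abbreviation QDiaP :: "qfm \<Rightarrow> qfm" where "QDiaP A \<equiv> QNot (QBoxP (QNot A))"

primrec qfv :: "qfm \<Rightarrow> var set" where
  "qfv QBot = {}"
| "qfv (QPred k xs) = set xs"
| "qfv (QImp A B) = qfv A \<union> qfv B"
| "qfv (QAll z A) = qfv A - {z}"
| "qfv (QBoxF A) = qfv A"
| "qfv (QBoxP A) = qfv A"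

primrec qsubst :: "var \<Rightarrow> var \<Rightarrow> qfm \<Rightarrow> qfm" where
  "qsubst y x QBot = QBot"
| "qsubst y x (QPred k xs) = QPred k (map (\<lambda>z. if z = x then y else z) xs)"
| "qsubst y x (QImp A B) = QImp (qsubst y x A) (qsubst y x B)"
| "qsubst y x (QAll z A) = QAll z (if z = x then A else qsubst y x A)"
| "qsubst y x (QBoxF A) = QBoxF (qsubst y x A)"
| "qsubst y x (QBoxP A) = QBoxP (qsubst y x A)"

primrec qfree_for :: "var \<Rightarrow> var \<Rightarrow> qfm \<Rightarrow> bool" where
  "qfree_for y x QBot = True"
| "qfree_for y x (QPred k xs) = True"
| "qfree_for y x (QImp A B) = (qfree_for y x A \<and> qfree_for y x B)"
| "qfree_for y x (QAll z A) = (x \<notin> qfv (QAll z A) \<or> (z \<noteq> y \<and> qfree_for y x A))"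
| "qfree_for y x (QBoxF A) = qfree_for y x A"
| "qfree_for y x (QBoxP A) = qfree_for y x A"

primrec tfm_to_qfm :: "(nat \<Rightarrow> qfm) \<Rightarrow> tfm \<Rightarrow> qfm" where
  "tfm_to_qfm s (TVar i) = s i"
| "tfm_to_qfm s TBot = QBot"
| "tfm_to_qfm s (TImp a b) = QImp (tfm_to_qfm s a) (tfm_to_qfm s b)"
| "tfm_to_qfm s (TBoxF a) = QBoxF (tfm_to_qfm s a)"
| "tfm_to_qfm s (TBoxP a) = QBoxP (tfm_to_qfm s a)"

inductive_set QS4t :: "qfm set" where
  QS4t_S4t: "p \<in> S4t \<Longrightarrow> tfm_to_qfm s p \<in> QS4t"
| QS4t_UI: "qfree_for y x A \<Longrightarrow> QAll y (QImp (QAll x A) (qsubst y x A)) \<in> QS4t"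
| QS4t_AllK: "QImp (QAll x (QImp A B)) (QImp (QAll x A) (QAll x B)) \<in> QS4t"
| QS4t_AllSwap: "QIff (QAll x (QAll y A)) (QAll y (QAll x A)) \<in> QS4t"
| QS4t_VacI: "x \<notin> qfv A \<Longrightarrow> QImp A (QAll x A) \<in> QS4t"
| QS4t_VacE: "x \<notin> qfv A \<Longrightarrow> QImp (QAll x A) A \<in> QS4t"
| QS4t_CBF: "QImp (QBoxF (QAll x A)) (QAll x (QBoxF A)) \<in> QS4t"
| QS4t_MP: "A \<in> QS4t \<Longrightarrow> QImp A B \<in> QS4t \<Longrightarrow> B \<in> QS4t"
| QS4t_Gen: "A \<in> QS4t \<Longrightarrow> QAll x A \<in> QS4t"
| QS4t_NecF: "A \<in> QS4t \<Longrightarrow> QBoxF A \<in> QS4t"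
| QS4t_NecP: "A \<in> QS4t \<Longrightarrow> QBoxP A \<in> QS4t"

definition QAlls :: "var list \<Rightarrow> qfm \<Rightarrow> qfm" where
  "QAlls xs A = foldr QAll xs A"


section \<open>The translation\<close>

primrec tense_trans :: "ifm \<Rightarrow> qfm" where
  "tense_trans IBot = QBot"
| "tense_trans (IPred k xs) = QBoxF (QPred k xs)"
| "tense_trans (IAnd A B) = QAnd (tense_trans A) (tense_trans B)"
| "tense_trans (IOr A B) = QOr (tense_trans A) (tense_trans B)"
| "tense_trans (IImp A B) = QBoxF (QImp (tense_trans A) (tense_trans B))"
| "tense_trans (IAll x A) = QBoxF (QAll x (tense_trans A))"
| "tense_trans (IEx x A) = QDiaP (QEx x (tense_trans A))"

end

theory Submission
  imports Defs "HOL-Library.Countable" "HOL-Library.Infinite_Set"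
begin

text \<open>Soundness is by induction on proofs in IQC: every translated formula \<open>A\<close> satisfies
  \<open>A \<longrightarrow> \<box>\<^sub>F A\<close>, so that \<open>\<diamond>\<^sub>P \<exists>x A\<close> collapses to \<open>\<exists>x A\<close>; only universal instantiation needs the
  universal closure. Faithfulness is by a canonical model. Its worlds are pairs of a prime Henkin
  theory of IQC and its domain of parameters, and read as a Kripke frame with increasing domains it
  is a model of QS4.t in which the translation of \<open>A\<close> holds at a world exactly when \<open>A\<close> belongs to
  that theory.\<close>

section \<open>Derivations in QS4.t\<close>

text \<open>In QS4.t a free variable may denote an object outside the current domain, so
  instantiation is available only under an outer \<open>QAll y\<close>. IQC instantiates freely, and
  Modus Ponens may lose free variables on the way; hence the induction on IQC proofs carries the
  provability of some universal closure. On the semantic side the past modality enters only through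
  the existential quantifier: a past witness is carried forward by persistence, and conversely each
  world is a past of itself. An intuitionistic canonical model, with the inverse order for the past,
  therefore suffices. The delicate point is capture: substitution in IQC does not rename bound
  variables, while the objects of the canonical domains are themselves variables. Two disjoint
  supplies of variables are kept, one for parameters and one for bound names.\<close>

instance qfm :: countable
  by countable_datatype

primrec qeval :: "(qfm \<Rightarrow> bool) \<Rightarrow> qfm \<Rightarrow> bool" where
  "qeval v QBot = False"
| "qeval v (QPred k xs) = v (QPred k xs)"
| "qeval v (QImp A B) = (qeval v A \<longrightarrow> qeval v B)"
| "qeval v (QAll x A) = v (QAll x A)"
| "qeval v (QBoxF A) = v (QBoxF A)"
| "qeval v (QBoxP A) = v (QBoxP A)"

text \<open>Tautologies enter QS4.t only as instances of propositional theorems. The skeleton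
  recovers such a theorem from a formula by coding each subformula headed by a predicate, quantifier
  or box as one propositional variable; decoding with \<open>from_nat\<close> gives the formula
  back.\<close>

primrec qskel :: "qfm \<Rightarrow> pfm" where
  "qskel QBot = PBot"
| "qskel (QPred k xs) = PVar (to_nat (QPred k xs))"
| "qskel (QImp A B) = PImp (qskel A) (qskel B)"
| "qskel (QAll x A) = PVar (to_nat (QAll x A))"
| "qskel (QBoxF A) = PVar (to_nat (QBoxF A))"
| "qskel (QBoxP A) = PVar (to_nat (QBoxP A))"

lemma peval_qskel: "peval v (qskel A) = qeval (\<lambda>B. v (to_nat B)) A"
  by (induction A) auto

lemma tfm_to_qfm_qskel: "tfm_to_qfm from_nat (pfm_to_tfm TVar (qskel A)) = A"
  by (induction A) auto

lemma QS4t_taut: "(\<And>v. qeval v A) \<Longrightarrow> A \<in> QS4t"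
  using QS4t_S4t[OF S4t_taut, of "qskel A" from_nat TVar]
  by (simp add: tfm_to_qfm_qskel classical_taut_def peval_qskel)

lemma QS4t_taut1: "A \<in> QS4t \<Longrightarrow> (\<And>v. qeval v A \<Longrightarrow> qeval v B) \<Longrightarrow> B \<in> QS4t"
  by (rule QS4t_MP[of A], assumption, rule QS4t_taut) simp

lemma QS4t_taut2:
  "A \<in> QS4t \<Longrightarrow> B \<in> QS4t \<Longrightarrow> (\<And>v. qeval v A \<Longrightarrow> qeval v B \<Longrightarrow> qeval v C) \<Longrightarrow> C \<in> QS4t"
  by (rule QS4t_MP[of B], assumption, erule QS4t_taut1) simp

lemma QS4t_taut3:
  "A \<in> QS4t \<Longrightarrow> B \<in> QS4t \<Longrightarrow> C \<in> QS4t \<Longrightarrow>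
    (\<And>v. qeval v A \<Longrightarrow> qeval v B \<Longrightarrow> qeval v C \<Longrightarrow> qeval v D) \<Longrightarrow> D \<in> QS4t"
  by (rule QS4t_MP[of C], assumption, erule QS4t_taut2, assumption) simp

lemma QS4t_modal_axioms:
  shows QS4t_KF: "QImp (QBoxF (QImp A B)) (QImp (QBoxF A) (QBoxF B)) \<in> QS4t"
    and QS4t_TF: "QImp (QBoxF A) A \<in> QS4t"
    and QS4t_4F: "QImp (QBoxF A) (QBoxF (QBoxF A)) \<in> QS4t"
    and QS4t_KP: "QImp (QBoxP (QImp A B)) (QImp (QBoxP A) (QBoxP B)) \<in> QS4t"
    and QS4t_TP: "QImp (QBoxP A) A \<in> QS4t"
    and QS4t_4P: "QImp (QBoxP A) (QBoxP (QBoxP A)) \<in> QS4t"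
    and QS4t_PF: "QImp A (QBoxP (QNot (QBoxF (QNot A)))) \<in> QS4t"
    and QS4t_FP: "QImp A (QBoxF (QDiaP A)) \<in> QS4t"
proof -
  note I = QS4t_S4t[where s = "\<lambda>i. [A, B] ! i"]
  show "QImp (QBoxF (QImp A B)) (QImp (QBoxF A) (QBoxF B)) \<in> QS4t"
    using I[OF S4t_KF[of "TVar 0" "TVar 1"]] by simp
  show "QImp (QBoxF A) A \<in> QS4t"
    using I[OF S4t_TF[of "TVar 0"]] by simp
  show "QImp (QBoxF A) (QBoxF (QBoxF A)) \<in> QS4t"
    using I[OF S4t_4F[of "TVar 0"]] by simp
  show "QImp (QBoxP (QImp A B)) (QImp (QBoxP A) (QBoxP B)) \<in> QS4t"
    using I[OF S4t_KP[of "TVar 0" "TVar 1"]] by simp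
  show "QImp (QBoxP A) (QBoxP (QBoxP A)) \<in> QS4t"
    using I[OF S4t_4P[of "TVar 0"]] by simp
  show "QImp (QBoxP A) A \<in> QS4t"
    using I[OF S4t_TP[of "TVar 0"]] by simp
  show "QImp A (QBoxP (QNot (QBoxF (QNot A)))) \<in> QS4t"
    using I[OF S4t_PF[of "TVar 0"]] by simp
  show "QImp A (QBoxF (QDiaP A)) \<in> QS4t"
    using I[OF S4t_FP[of "TVar 0"]] by simp
qed

section \<open>Monotonicity of the operators and the tense adjunction\<close>

lemma QBoxF_mono: "QImp A B \<in> QS4t \<Longrightarrow> QImp (QBoxF A) (QBoxF B) \<in> QS4t"
  by (meson QS4t_KF QS4t_MP QS4t_NecF)

lemma QBoxP_mono: "QImp A B \<in> QS4t \<Longrightarrow> QImp (QBoxP A) (QBoxP B) \<in> QS4t"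
  by (meson QS4t_KP QS4t_MP QS4t_NecP)

lemma QAll_mono: "QImp A B \<in> QS4t \<Longrightarrow> QImp (QAll x A) (QAll x B) \<in> QS4t"
  by (meson QS4t_AllK QS4t_MP QS4t_Gen)

lemma QImp_trans: "QImp A B \<in> QS4t \<Longrightarrow> QImp B C \<in> QS4t \<Longrightarrow> QImp A C \<in> QS4t"
  by (erule QS4t_taut2, assumption) simp

lemma QDiaP_mono: "QImp A B \<in> QS4t \<Longrightarrow> QImp (QDiaP A) (QDiaP B) \<in> QS4t"
proof -
  assume "QImp A B \<in> QS4t"
  then have "QImp (QNot B) (QNot A) \<in> QS4t"
    by (rule QS4t_taut1) auto
  from QBoxP_mono[OF this] show ?thesis
    by (rule QS4t_taut1) auto
qed

text \<open>The past diamond is left adjoint to the future box, and this is the counit. It is the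
  contrapositive of the axiom \<open>QS4t_PF\<close> taken at \<open>QNot A\<close>.\<close>

lemma QDiaP_QBoxF: "QImp (QDiaP (QBoxF A)) A \<in> QS4t"
proof -
  have "QImp (QBoxP (QNot (QBoxF (QNot (QNot A))))) (QBoxP (QNot (QBoxF A))) \<in> QS4t"
    by (rule QBoxP_mono, rule QS4t_taut1[OF QBoxF_mono[of A "QNot (QNot A)"]])
      (auto intro: QS4t_taut)
  then show ?thesis
    using QS4t_PF[of "QNot A"] by (rule QS4t_taut2) auto
qed

text \<open>Syntactic form of the upward closure of truth in intuitionistic Kripke models.\<close>

definition persistent :: "qfm \<Rightarrow> bool" where
  "persistent A \<longleftrightarrow> QImp A (QBoxF A) \<in> QS4t"

lemma persistent_QBoxF: "persistent (QBoxF A)"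
  by (simp add: persistent_def QS4t_4F)

lemma persistent_QBot: "persistent QBot"
  unfolding persistent_def by (rule QS4t_taut) simp

lemma persistent_QAnd:
  assumes "persistent A" "persistent B"
  shows "persistent (QAnd A B)"
proof -
  have "QImp (QBoxF A) (QBoxF (QImp B (QAnd A B))) \<in> QS4t"
    by (rule QBoxF_mono, rule QS4t_taut) simp
  then have "QImp (QBoxF A) (QImp (QBoxF B) (QBoxF (QAnd A B))) \<in> QS4t"
    using QS4t_KF by (rule QImp_trans)
  then show ?thesis
    using assms unfolding persistent_def by - (erule QS4t_taut3, assumption, assumption, simp)
qed

lemma persistent_QOr:
  assumes "persistent A" "persistent B"
  shows "persistent (QOr A B)"
proof -
  have "QImp (QBoxF A) (QBoxF (QOr A B)) \<in> QS4t" "QImp (QBoxF B) (QBoxF (QOr A B)) \<in> QS4t"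
    by (rule QBoxF_mono, rule QS4t_taut, simp)+
  then have "QImp A (QBoxF (QOr A B)) \<in> QS4t" "QImp B (QBoxF (QOr A B)) \<in> QS4t"
    using assms QImp_trans unfolding persistent_def by blast+
  then show ?thesis
    unfolding persistent_def by (rule QS4t_taut2) auto
qed

text \<open>Whatever was once true in the past stays so: \<open>QS4t_FP\<close> puts two past
  diamonds under the future box, and transitivity of the past merges them.\<close>

lemma persistent_QDiaP: "persistent (QDiaP A)"
proof -
  have "QImp (QDiaP (QDiaP A)) (QDiaP A) \<in> QS4t"
  proof -
    have "QImp (QBoxP (QBoxP (QNot A))) (QBoxP (QNot (QDiaP A))) \<in> QS4t"
      by (rule QBoxP_mono, rule QS4t_taut) auto
    with QS4t_4P[of "QNot A"] show ?thesis
      by (rule QS4t_taut2) auto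
  qed
  then show ?thesis
    unfolding persistent_def by (rule QImp_trans[OF QS4t_FP QBoxF_mono])
qed

lemma persistent_tense_trans: "persistent (tense_trans A)"
  by (induction A)
    (simp_all add: persistent_QBot persistent_QBoxF persistent_QAnd persistent_QOr persistent_QDiaP)

lemma persistent_imp_QBoxF: "persistent A \<Longrightarrow> QImp A B \<in> QS4t \<Longrightarrow> QImp A (QBoxF B) \<in> QS4t"
  unfolding persistent_def by (meson QBoxF_mono QImp_trans)

lemma persistent_imp2_QBoxF:
  assumes "persistent A" "persistent B" "QImp A (QImp B C) \<in> QS4t"
  shows "QImp A (QImp B (QBoxF C)) \<in> QS4t"
proof -
  have "QImp (QAnd A B) C \<in> QS4t"
    using assms(3) by (rule QS4t_taut1) simp
  then have "QImp (QAnd A B) (QBoxF C) \<in> QS4t"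
    by (rule persistent_imp_QBoxF[OF persistent_QAnd[OF assms(1,2)]])
  then show ?thesis
    by (rule QS4t_taut1) simp
qed

text \<open>Nested implications translate to nested future boxes. Persistence of the outer
  antecedent lets a propositional implication acquire its inner box; the last antecedent needs no
  persistence.\<close>

lemma strict_imp2:
  assumes "persistent A" "QImp A (QImp B C) \<in> QS4t"
  shows "QBoxF (QImp A (QBoxF (QImp B C))) \<in> QS4t"
  using assms by (intro QS4t_NecF persistent_imp_QBoxF)

lemma strict_imp3:
  assumes "persistent A" "persistent B" "QImp A (QImp B (QImp C D)) \<in> QS4t"
  shows "QBoxF (QImp A (QBoxF (QImp B (QBoxF (QImp C D))))) \<in> QS4t"
  using assms by (intro strict_imp2 persistent_imp2_QBoxF)

lemma qfree_for_self: "qfree_for x x A"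
  by (induction A) auto

lemma qsubst_self [simp]: "qsubst x x A = A"
  by (induction A) (auto intro: map_idI)

text \<open>The contrapositive of instantiation for \<open>QNot A\<close>. The outer quantifier
  remains, since it guarantees that \<open>y\<close> denotes an existing object.\<close>

lemma QEx_intro_closed:
  assumes "qfree_for y x A"
  shows "QAll y (QImp (qsubst y x A) (QEx x A)) \<in> QS4t"
proof -
  have "QImp (QImp (QAll x (QNot A)) (QNot (qsubst y x A))) (QImp (qsubst y x A) (QEx x A)) \<in> QS4t"
    by (rule QS4t_taut) auto
  then show ?thesis
    using QS4t_UI[of y x "QNot A"] assms by (auto dest: QAll_mono intro: QS4t_MP)
qed

text \<open>The converse Barcan formula makes domains grow towards the future, so a witness stays
  available.\<close>

lemma QEx_persistent:
  assumes "persistent A"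
  shows "persistent (QEx x A)"
proof -
  have "QAll x (QImp A (QEx x A)) \<in> QS4t"
    using QEx_intro_closed[OF qfree_for_self, of x A] by simp
  then have "QAll x (QBoxF (QImp A (QEx x A))) \<in> QS4t"
    by (meson QS4t_CBF QS4t_MP QS4t_NecF)
  moreover have "QImp (QBoxF (QImp A (QEx x A))) (QImp A (QBoxF (QEx x A))) \<in> QS4t"
    using QS4t_KF assms unfolding persistent_def by (rule QS4t_taut2) auto
  then have "QImp (QBoxF (QImp A (QEx x A))) (QImp (QNot (QBoxF (QEx x A))) (QNot A)) \<in> QS4t"
    by (rule QS4t_taut1) auto
  ultimately have "QAll x (QImp (QNot (QBoxF (QEx x A))) (QNot A)) \<in> QS4t"
    by (meson QAll_mono QS4t_MP)
  then have "QImp (QAll x (QNot (QBoxF (QEx x A)))) (QAll x (QNot A)) \<in> QS4t"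
    by (meson QS4t_AllK QS4t_MP)
  moreover have "QImp (QNot (QBoxF (QEx x A))) (QAll x (QNot (QBoxF (QEx x A)))) \<in> QS4t"
    by (rule QS4t_VacI) simp
  ultimately show ?thesis
    unfolding persistent_def by (rule QS4t_taut2) auto
qed

lemma QDiaP_persistent: "persistent A \<Longrightarrow> QImp (QDiaP A) A \<in> QS4t"
  unfolding persistent_def by (rule QImp_trans[OF QDiaP_mono QDiaP_QBoxF])

lemma QDiaP_intro: "QImp A (QDiaP A) \<in> QS4t"
  by (rule QS4t_taut1[OF QS4t_TP[of "QNot A"]]) auto

subsection \<open>Provability of universal closures\<close>

lemma QAlls_simps [simp]:
  "QAlls [] A = A" "QAlls (x # xs) A = QAll x (QAlls xs A)"
  "QAlls (xs @ ys) A = QAlls xs (QAlls ys A)"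
  by (simp_all add: QAlls_def)

lemma qfv_QAlls [simp]: "qfv (QAlls xs A) = qfv A - set xs"
  by (induction xs) auto

lemma QAlls_Gen: "A \<in> QS4t \<Longrightarrow> QAlls xs A \<in> QS4t"
  by (induction xs) (auto intro: QS4t_Gen)

lemma QAlls_K: "QImp (QAlls xs (QImp A B)) (QImp (QAlls xs A) (QAlls xs B)) \<in> QS4t"
proof (induction xs)
  case (Cons x xs)
  then show ?case
    using QImp_trans[OF QAll_mono QS4t_AllK] by simp
qed (auto intro: QS4t_taut)

lemma QAll_swap: "QImp (QAll x (QAll y A)) (QAll y (QAll x A)) \<in> QS4t"
  using QS4t_AllSwap[of x y A] by (rule QS4t_taut1) simp

lemma QAll_QAlls_swap: "QImp (QAll x (QAlls ys A)) (QAlls ys (QAll x A)) \<in> QS4t"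
proof (induction ys)
  case (Cons y ys)
  then show ?case
    using QImp_trans[OF QAll_swap QAll_mono] by simp
qed (auto intro: QS4t_taut)

lemma QAlls_swap: "QImp (QAlls xs (QAlls ys A)) (QAlls ys (QAlls xs A)) \<in> QS4t"
proof (induction xs)
  case (Cons x xs)
  then show ?case
    using QImp_trans[OF QAll_mono QAll_QAlls_swap] by simp
qed (auto intro: QS4t_taut)

lemma QAlls_vacuous: "set xs \<inter> qfv A = {} \<Longrightarrow> QImp (QAlls xs A) A \<in> QS4t"
proof (induction xs)
  case (Cons x xs)
  then show ?case
    using QImp_trans[OF QAll_mono QS4t_VacE[of x A]] by simp
qed (auto intro: QS4t_taut)

lemma QAlls_CBF: "QImp (QBoxF (QAlls xs A)) (QAlls xs (QBoxF A)) \<in> QS4t"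
proof (induction xs)
  case (Cons x xs)
  then show ?case
    using QImp_trans[OF QS4t_CBF QAll_mono] by simp
qed (auto intro: QS4t_taut)

text \<open>The list is left unspecified so that no step of the induction has to track free
  variables; \<open>closed_provable_QAlls\<close> later replaces it by any list that covers
  them.\<close>

definition closed_provable :: "qfm \<Rightarrow> bool" where
  "closed_provable A \<longleftrightarrow> (\<exists>xs. QAlls xs A \<in> QS4t)"

lemma closed_provable_QAlls:
  assumes "closed_provable A" "qfv A \<subseteq> set ys"
  shows "QAlls ys A \<in> QS4t"
proof -
  obtain xs where "QAlls xs A \<in> QS4t"
    using assms(1) closed_provable_def by blast
  then have "QAlls xs (QAlls ys A) \<in> QS4t"
    by (rule QS4t_MP[OF QAlls_Gen QAlls_swap])
  then show ?thesis
    by (rule QS4t_MP[OF _ QAlls_vacuous]) (use assms(2) in auto)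
qed

lemma closed_provable_QS4t: "A \<in> QS4t \<Longrightarrow> closed_provable A"
  unfolding closed_provable_def by (metis QAlls_simps(1))

lemma closed_provable_QAllD: "QAll x A \<in> QS4t \<Longrightarrow> closed_provable A"
  unfolding closed_provable_def by (metis QAlls_simps(1,2))

lemma closed_provable_MP:
  assumes "closed_provable A" "closed_provable (QImp A B)"
  shows "closed_provable B"
proof -
  obtain xs ys where "QAlls xs A \<in> QS4t" "QAlls ys (QImp A B) \<in> QS4t"
    using assms closed_provable_def by blast
  \<comment> \<open>Both premises get a common prefix: \<open>A\<close> is generalized over
    \<open>ys\<close>, the implication over \<open>xs\<close> with a subsequent exchange of
    blocks.\<close>
  then have "QAlls (ys @ xs) A \<in> QS4t" "QAlls (ys @ xs) (QImp A B) \<in> QS4t"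
    by (auto intro: QAlls_Gen QS4t_MP[OF _ QAlls_swap])
  then show ?thesis
    unfolding closed_provable_def using QAlls_K QS4t_MP by blast
qed

lemma closed_provable_QAll: "closed_provable A \<Longrightarrow> closed_provable (QAll x A)"
  unfolding closed_provable_def by (meson QAll_QAlls_swap QS4t_Gen QS4t_MP)

text \<open>Necessitation puts the box outside the closure; the converse Barcan formula moves it
  inside.\<close>

lemma closed_provable_QBoxF: "closed_provable A \<Longrightarrow> closed_provable (QBoxF A)"
  unfolding closed_provable_def by (meson QAlls_CBF QS4t_NecF QS4t_MP)

lemma closed_provable_imp:
  "closed_provable A \<Longrightarrow> QImp A B \<in> QS4t \<Longrightarrow> closed_provable B"
  using closed_provable_MP closed_provable_QS4t by blast

section \<open>Soundness of the translation\<close>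

lemma qfv_tense_trans [simp]: "qfv (tense_trans A) = ifv A"
  by (induction A) auto

lemma tense_trans_isubst: "tense_trans (isubst y x A) = qsubst y x (tense_trans A)"
  by (induction A) auto

lemma qfree_for_tense_trans: "ifree_for y x A \<Longrightarrow> qfree_for y x (tense_trans A)"
  by (induction A) auto

lemma closed_provable_tense_trans_IPC:
  "p \<in> IPC \<Longrightarrow> closed_provable (tense_trans (pfm_to_ifm s p))"
proof (induction rule: IPC.induct)
  case (IPC_MP a b)
  have "closed_provable (QImp (tense_trans (pfm_to_ifm s a)) (tense_trans (pfm_to_ifm s b)))"
    using IPC_MP.IH(2) by (auto intro: closed_provable_imp QS4t_TF)
  then show ?case
    by (rule closed_provable_MP[OF IPC_MP.IH(1)])
next
  case (IPC_K a b)
  show ?case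
    unfolding pfm_to_ifm.simps tense_trans.simps
    by (intro closed_provable_QS4t strict_imp2 persistent_tense_trans QS4t_taut) simp
next
  case (IPC_AndI a b)
  show ?case
    unfolding pfm_to_ifm.simps tense_trans.simps
    by (intro closed_provable_QS4t strict_imp2 persistent_tense_trans QS4t_taut) simp
next
  case (IPC_S a b c)
  let ?a = "tense_trans (pfm_to_ifm s a)" and ?b = "tense_trans (pfm_to_ifm s b)"
    and ?c = "tense_trans (pfm_to_ifm s c)"
  have "QImp (QBoxF (QImp ?a (QBoxF (QImp ?b ?c)))) (QImp (QBoxF (QImp ?a ?b)) (QImp ?a ?c)) \<in> QS4t"
    by (rule QS4t_taut3[OF QS4t_TF[of "QImp ?a (QBoxF (QImp ?b ?c))"] QS4t_TF[of "QImp ?b ?c"]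
      QS4t_TF[of "QImp ?a ?b"]]) auto
  then show ?case
    by (auto intro!: closed_provable_QS4t strict_imp3 persistent_QBoxF)
next
  case (IPC_OrE a c b)
  let ?a = "tense_trans (pfm_to_ifm s a)" and ?b = "tense_trans (pfm_to_ifm s b)"
    and ?c = "tense_trans (pfm_to_ifm s c)"
  have "QImp (QBoxF (QImp ?a ?c)) (QImp (QBoxF (QImp ?b ?c)) (QImp (QOr ?a ?b) ?c)) \<in> QS4t"
    by (rule QS4t_taut2[OF QS4t_TF[of "QImp ?a ?c"] QS4t_TF[of "QImp ?b ?c"]]) auto
  then show ?case
    by (auto intro!: closed_provable_QS4t strict_imp3 persistent_QBoxF)
\<comment> \<open>The remaining axioms have a single implication at the top and translate to one
  future box in front of a tautology.\<close>
qed (simp, rule closed_provable_QS4t[OF QS4t_NecF[OF QS4t_taut]], simp)+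

text \<open>Closures arise at the two instantiation axioms, where the outer quantifier of the QS4.t
  scheme has to be absorbed, and are then carried along by the rules.\<close>

lemma closed_provable_tense_trans: "A \<in> IQC \<Longrightarrow> closed_provable (tense_trans A)"
proof (induction rule: IQC.induct)
  case (IQC_IPC p s)
  then show ?case by (rule closed_provable_tense_trans_IPC)
next
  case (IQC_AllE y x A)
  let ?A = "tense_trans A"
  have "closed_provable (QImp (QAll x ?A) (qsubst y x ?A))"
    by (rule closed_provable_QAllD[OF QS4t_UI[OF qfree_for_tense_trans[OF IQC_AllE]]])
  then have "closed_provable (QImp (QBoxF (QAll x ?A)) (qsubst y x ?A))"
    by (rule closed_provable_imp) (rule QS4t_taut1[OF QS4t_TF[of "QAll x ?A"]], simp)
  then show ?case
    by (simp add: tense_trans_isubst closed_provable_QBoxF)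
next
  case (IQC_ExI y x A)
  let ?A = "tense_trans A"
  have "closed_provable (QImp (qsubst y x ?A) (QEx x ?A))"
    by (rule closed_provable_QAllD[OF QEx_intro_closed[OF qfree_for_tense_trans[OF IQC_ExI]]])
  then have "closed_provable (QImp (qsubst y x ?A) (QDiaP (QEx x ?A)))"
    by (rule closed_provable_imp) (rule QS4t_taut1[OF QDiaP_intro[of "QEx x ?A"]], simp)
  then show ?case
    using closed_provable_QBoxF by (simp add: tense_trans_isubst)
next
  case (IQC_AllI x A B)
  let ?A = "tense_trans A" and ?B = "tense_trans B"
  let ?C = "QBoxF (QAll x (QBoxF (QImp ?A ?B)))"
  have "QImp ?C (QAll x (QImp ?A ?B)) \<in> QS4t"
    by (rule QImp_trans[OF QS4t_TF QAll_mono[OF QS4t_TF]])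
  then have "QImp ?C (QImp (QAll x ?A) (QAll x ?B)) \<in> QS4t"
    using QS4t_AllK by (rule QImp_trans)
  then have "QImp ?C (QImp ?A (QAll x ?B)) \<in> QS4t"
    by (rule QS4t_taut2[OF _ QS4t_VacI[of x ?A]]) (use IQC_AllI in auto)
  then have "QImp ?C (QImp ?A (QBoxF (QAll x ?B))) \<in> QS4t"
    by (intro persistent_imp2_QBoxF persistent_QBoxF persistent_tense_trans)
  then show ?case
    by (auto intro!: closed_provable_QS4t strict_imp2 persistent_QBoxF)
next
  case (IQC_ExE x B A)
  let ?A = "tense_trans A" and ?B = "tense_trans B"
  let ?C = "QBoxF (QAll x (QBoxF (QImp ?A ?B)))"
  have "QImp (QBoxF (QImp ?A ?B)) (QImp (QNot ?B) (QNot ?A)) \<in> QS4t"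
    using QS4t_TF by (rule QS4t_taut1) auto
  then have "QImp ?C (QAll x (QImp (QNot ?B) (QNot ?A))) \<in> QS4t"
    by (intro QImp_trans[OF QS4t_TF QAll_mono])
  then have "QImp ?C (QImp (QAll x (QNot ?B)) (QAll x (QNot ?A))) \<in> QS4t"
    using QS4t_AllK by (rule QImp_trans)
  moreover have "QImp (QNot ?B) (QAll x (QNot ?B)) \<in> QS4t"
    using IQC_ExE by (intro QS4t_VacI) simp
  \<comment> \<open>Here the past diamond of the translation disappears, which leaves the classical
    argument by contraposition.\<close>
  moreover have "QImp (QDiaP (QEx x ?A)) (QEx x ?A) \<in> QS4t"
    by (intro QDiaP_persistent QEx_persistent persistent_tense_trans)
  ultimately have "QImp ?C (QImp (QDiaP (QEx x ?A)) ?B) \<in> QS4t"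
    by (rule QS4t_taut3) auto
  then show ?case
    by (auto intro!: closed_provable_QS4t strict_imp2 persistent_QBoxF)
next
  case (IQC_MP A B)
  have "closed_provable (QImp (tense_trans A) (tense_trans B))"
    using IQC_MP.IH(2) by (auto intro: closed_provable_imp QS4t_TF)
  then show ?case
    by (rule closed_provable_MP[OF IQC_MP.IH(1)])
next
  case (IQC_Gen A x)
  then show ?case
    by (simp add: closed_provable_QAll closed_provable_QBoxF)
qed

section \<open>Derivations in IQC from assumptions\<close>

instance ifm :: countable
  by countable_datatype

lemma IQC_axioms:
  shows IQC_K: "IImp A (IImp B A) \<in> IQC"
    and IQC_S: "IImp (IImp A (IImp B C)) (IImp (IImp A B) (IImp A C)) \<in> IQC"
    and IQC_AndE1: "IImp (IAnd A B) A \<in> IQC"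
    and IQC_AndE2: "IImp (IAnd A B) B \<in> IQC"
    and IQC_AndI: "IImp A (IImp B (IAnd A B)) \<in> IQC"
    and IQC_OrI1: "IImp A (IOr A B) \<in> IQC"
    and IQC_OrI2: "IImp B (IOr A B) \<in> IQC"
    and IQC_OrE: "IImp (IImp A C) (IImp (IImp B C) (IImp (IOr A B) C)) \<in> IQC"
    and IQC_BotE: "IImp IBot A \<in> IQC"
proof -
  let ?s = "\<lambda>i. [A, B, C] ! i"
  note I = IQC_IPC[where s = ?s]
  show "IImp A (IImp B A) \<in> IQC"
    using I[OF IPC_K[of "PVar 0" "PVar 1"]] by simp
  show "IImp (IImp A (IImp B C)) (IImp (IImp A B) (IImp A C)) \<in> IQC"
    using I[OF IPC_S[of "PVar 0" "PVar 1" "PVar 2"]] by simp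
  show "IImp (IAnd A B) A \<in> IQC"
    using I[OF IPC_AndE1[of "PVar 0" "PVar 1"]] by simp
  show "IImp (IAnd A B) B \<in> IQC"
    using I[OF IPC_AndE2[of "PVar 0" "PVar 1"]] by simp
  show "IImp A (IImp B (IAnd A B)) \<in> IQC"
    using I[OF IPC_AndI[of "PVar 0" "PVar 1"]] by simp
  show "IImp A (IOr A B) \<in> IQC"
    using I[OF IPC_OrI1[of "PVar 0" "PVar 1"]] by simp
  show "IImp B (IOr A B) \<in> IQC"
    using I[OF IPC_OrI2[of "PVar 1" "PVar 0"]] by simp
  show "IImp (IImp A C) (IImp (IImp B C) (IImp (IOr A B) C)) \<in> IQC"
    using I[OF IPC_OrE[of "PVar 0" "PVar 2" "PVar 1"]] by simp
  show "IImp IBot A \<in> IQC"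
    using I[OF IPC_BotE[of "PVar 0"]] by simp
qed

text \<open>Generalization acts only inside IQC, never on assumptions, so the deduction theorem
  holds without side conditions. It comes back for derivations as \<open>der_Gen\<close>, with a
  freshness condition.\<close>

inductive der :: "ifm set \<Rightarrow> ifm \<Rightarrow> bool" for \<Gamma> where
  der_IQC: "A \<in> IQC \<Longrightarrow> der \<Gamma> A"
| der_asm: "A \<in> \<Gamma> \<Longrightarrow> der \<Gamma> A"
| der_MP: "der \<Gamma> A \<Longrightarrow> der \<Gamma> (IImp A B) \<Longrightarrow> der \<Gamma> B"

lemma der_mono: "der \<Gamma> A \<Longrightarrow> \<Gamma> \<subseteq> \<Delta> \<Longrightarrow> der \<Delta> A"
  by (induction rule: der.induct) (auto intro: der.intros)

lemma der_empty_iff: "der {} A \<longleftrightarrow> A \<in> IQC"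
proof
  show "der {} A \<Longrightarrow> A \<in> IQC"
    by (induction rule: der.induct) (auto intro: IQC_MP)
qed (rule der_IQC)

lemma der_IQC_MP: "IImp A B \<in> IQC \<Longrightarrow> der \<Gamma> A \<Longrightarrow> der \<Gamma> B"
  by (meson der_IQC der_MP)

lemma der_refl: "der \<Gamma> (IImp A A)"
  by (meson IQC_K IQC_S der_IQC der_MP)

lemma der_deduction_iff: "der (insert A \<Gamma>) B \<longleftrightarrow> der \<Gamma> (IImp A B)"
proof
  show "der (insert A \<Gamma>) B \<Longrightarrow> der \<Gamma> (IImp A B)"
  proof (induction rule: der.induct)
    case (der_MP B C)
    then show ?case
      by (meson IQC_S der.der_IQC der.der_MP)
  qed (auto intro: der_refl der_IQC_MP[OF IQC_K] der.intros)
  show "der \<Gamma> (IImp A B) \<Longrightarrow> der (insert A \<Gamma>) B"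
    by (meson der_MP der_asm der_mono insertI1 subset_insertI)
qed

lemma IQC_Imp_iff: "IImp A B \<in> IQC \<longleftrightarrow> der {A} B"
  by (simp add: der_deduction_iff der_empty_iff)

lemma der_cut: "der \<Gamma> A \<Longrightarrow> der (insert A \<Gamma>) B \<Longrightarrow> der \<Gamma> B"
  by (meson der_MP der_deduction_iff)

lemma der_OrE:
  "der (insert A \<Gamma>) C \<Longrightarrow> der (insert B \<Gamma>) C \<Longrightarrow> der \<Gamma> (IOr A B) \<Longrightarrow> der \<Gamma> C"
  unfolding der_deduction_iff by (meson IQC_OrE der_IQC der_MP)

section \<open>Bound variables, substitution and provable renaming\<close>

primrec ibv :: "ifm \<Rightarrow> var set" where
  "ibv IBot = {}"
| "ibv (IPred k xs) = {}"
| "ibv (IAnd A B) = ibv A \<union> ibv B"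
| "ibv (IOr A B) = ibv A \<union> ibv B"
| "ibv (IImp A B) = ibv A \<union> ibv B"
| "ibv (IAll z A) = insert z (ibv A)"
| "ibv (IEx z A) = insert z (ibv A)"

lemma finite_ifv [simp]: "finite (ifv A)" and finite_ibv [simp]: "finite (ibv A)"
  by (induction A) auto

lemma ifree_for_notin_ibv: "y \<notin> ibv A \<Longrightarrow> ifree_for y x A"
  by (induction A) auto

lemma ifree_for_notin_ifv: "x \<notin> ifv A \<Longrightarrow> ifree_for y x A"
  by (induction A) auto

lemma ifree_for_self: "ifree_for x x A"
  by (induction A) auto

lemma isubst_notin_ifv: "x \<notin> ifv A \<Longrightarrow> isubst y x A = A"
  by (induction A) (auto intro: map_idI)

lemma isubst_self [simp]: "isubst x x A = A"
  by (induction A) (auto intro: map_idI)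

lemma ifv_isubst_subset: "ifv (isubst y x A) \<subseteq> insert y (ifv A - {x})"
  by (induction A) auto

lemma isubst_isubst_cancel: "y \<notin> ifv A \<Longrightarrow> y \<notin> ibv A \<Longrightarrow> isubst x y (isubst y x A) = A"
  by (induction A) (auto intro!: map_idI simp: isubst_notin_ifv)

lemma ifree_for_isubst_cancel: "y \<notin> ifv A \<Longrightarrow> y \<notin> ibv A \<Longrightarrow> ifree_for x y (isubst y x A)"
proof (induction A)
  case (IAll z A)
  then show ?case by (auto simp: ifree_for_notin_ifv)
next
  case (IEx z A)
  then show ?case by (auto simp: ifree_for_notin_ifv)
qed auto

lemma IQC_AllE_same: "IImp (IAll x A) A \<in> IQC"
  using IQC_AllE[OF ifree_for_self, of x A] by simp

lemma IQC_AllK: "IImp (IAll x (IImp A B)) (IImp (IAll x A) (IAll x B)) \<in> IQC"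
proof -
  have "der {IAll x A, IAll x (IImp A B)} B"
    by (meson IQC_AllE_same der_IQC_MP der_MP der_asm insertI1 insertI2)
  then have *: "IImp (IAll x (IImp A B)) (IImp (IAll x A) B) \<in> IQC"
    by (simp add: der_deduction_iff flip: der_empty_iff)
  have "der {} (IImp (IAll x (IImp A B)) (IAll x (IImp (IAll x A) B)))"
    by (rule der_IQC_MP[OF IQC_AllI]) (auto intro: der_IQC IQC_Gen *)
  then have "der {IAll x (IImp A B)} (IAll x (IImp (IAll x A) B))"
    by (simp add: der_deduction_iff)
  then have "der {IAll x (IImp A B)} (IImp (IAll x A) (IAll x B))"
    by (rule der_IQC_MP[OF IQC_AllI, rotated]) simp
  then show ?thesis
    by (simp add: der_deduction_iff der_empty_iff)
qed

lemma der_Gen: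
  assumes "der \<Gamma> A" and x: "\<forall>B\<in>\<Gamma>. x \<notin> ifv B"
  shows "der \<Gamma> (IAll x A)"
  using assms(1)
proof (induction rule: der.induct)
  case (der_IQC A)
  then show ?case by (simp add: der.der_IQC IQC_Gen)
next
  case (der_asm A)
  \<comment> \<open>The scheme \<open>IQC_AllI\<close> is applied to the generalization of
    \<open>IImp A A\<close>.\<close>
  have "IImp A (IAll x A) \<in> IQC"
    using IQC_AllI[of x A A] IQC_Gen[of "IImp A A" x] der_refl[of "{}" A] x der_asm
    by (auto simp: der_empty_iff intro: IQC_MP)
  then show ?case
    using der.der_asm der_IQC_MP der_asm by blast
next
  case (der_MP A B)
  then show ?case
    by (meson IQC_AllK der.der_MP der_IQC_MP)
qed

lemma der_Ex_elim:
  assumes "der (insert A \<Gamma>) C" and "\<forall>B\<in>\<Gamma>. x \<notin> ifv B" and "x \<notin> ifv C" and "der \<Gamma> (IEx x A)"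
  shows "der \<Gamma> C"
  using assms by (meson IQC_ExE der_Gen der_IQC_MP der_MP der_deduction_iff)

text \<open>Alpha-equivalent formulas are different terms here, so renaming a binder has to be
  derived. A \<open>y\<close> that occurs neither free nor bound makes the substitution reversible,
  which gives both directions.\<close>

lemma der_All_rename:
  assumes "y \<notin> ifv A" "y \<notin> ibv A"
  shows "der {IAll x A} (IAll y (isubst y x A))" and "der {IAll y (isubst y x A)} (IAll x A)"
proof -
  show "der {IAll x A} (IAll y (isubst y x A))"
    using assms by (intro der_Gen der_IQC_MP[OF IQC_AllE] ifree_for_notin_ibv der_asm) auto
  have "der {IAll y (isubst y x A)} (isubst x y (isubst y x A))"
    using assms by (intro der_IQC_MP[OF IQC_AllE] ifree_for_isubst_cancel der_asm) auto
  then show "der {IAll y (isubst y x A)} (IAll x A)"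
    using assms ifv_isubst_subset[of y x A]
    by (intro der_Gen) (auto simp: isubst_isubst_cancel)
qed

lemma der_Ex_rename:
  assumes "y \<notin> ifv A" "y \<notin> ibv A"
  shows "der {IEx x A} (IEx y (isubst y x A))" and "der {IEx y (isubst y x A)} (IEx x A)"
proof -
  have "der {isubst y x A} (IEx x A)"
    using assms by (intro der_IQC_MP[OF IQC_ExI] ifree_for_notin_ibv der_asm) auto
  then have "der {isubst y x A, IEx y (isubst y x A)} (IEx x A)"
    by (rule der_mono) auto
  then show "der {IEx y (isubst y x A)} (IEx x A)"
    by (rule der_Ex_elim) (use assms in \<open>auto intro: der_asm\<close>)
  have "der {isubst x y (isubst y x A)} (IEx y (isubst y x A))"
    using assms
    by (intro der_IQC_MP[OF IQC_ExI[OF ifree_for_isubst_cancel]] der_asm) auto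
  then have "der {A, IEx x A} (IEx y (isubst y x A))"
    unfolding isubst_isubst_cancel[OF assms] by (rule der_mono) auto
  then show "der {IEx x A} (IEx y (isubst y x A))"
    by (rule der_Ex_elim) (use assms ifv_isubst_subset[of y x A] in \<open>auto intro: der_asm\<close>)
qed

section \<open>Congruence of derivability for the connectives and quantifiers\<close>

lemma der_trans: "der \<Gamma> A \<Longrightarrow> der {A} B \<Longrightarrow> der \<Gamma> B"
  by (meson IQC_Imp_iff der_IQC_MP)

lemma der_AndI: "der \<Gamma> A \<Longrightarrow> der \<Gamma> B \<Longrightarrow> der \<Gamma> (IAnd A B)"
  by (meson IQC_AndI der_IQC_MP der_MP)

lemma der_And_mono: "der {A} A' \<Longrightarrow> der {B} B' \<Longrightarrow> der {IAnd A B} (IAnd A' B')"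
  by (meson IQC_AndE1 IQC_AndE2 IQC_Imp_iff der_AndI der_trans)

lemma der_Or_mono:
  assumes "der {A} A'" "der {B} B'"
  shows "der {IOr A B} (IOr A' B')"
proof (rule der_OrE[of A _ _ B])
  show "der {A, IOr A B} (IOr A' B')"
    by (rule der_IQC_MP[OF IQC_OrI1 der_mono[OF assms(1)]]) simp
  show "der {B, IOr A B} (IOr A' B')"
    by (rule der_IQC_MP[OF IQC_OrI2 der_mono[OF assms(2)]]) simp
qed (simp add: der_asm)

lemma der_Imp_mono:
  assumes "der {A'} A" "der {B} B'"
  shows "der {IImp A B} (IImp A' B')"
proof -
  have "der {A', IImp A B} A"
    using assms(1) by (rule der_mono) simp
  then have "der {A', IImp A B} B"
    by (rule der_MP) (simp add: der_asm)
  then have "der {A', IImp A B} B'"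
    using assms(2) by (rule der_trans)
  then show ?thesis
    by (simp only: der_deduction_iff)
qed

lemma der_All_mono: "der {A} B \<Longrightarrow> der {IAll x A} (IAll x B)"
  by (rule der_Gen, rule der_trans[OF der_IQC_MP[OF IQC_AllE_same der_asm]]) auto

lemma IQC_ExI_same: "IImp A (IEx x A) \<in> IQC"
  using IQC_ExI[OF ifree_for_self, of x A] by simp

lemma der_Ex_mono:
  assumes "der {A} B"
  shows "der {IEx x A} (IEx x B)"
proof (rule der_Ex_elim[of A])
  show "der {A, IEx x A} (IEx x B)"
    by (rule der_IQC_MP[OF IQC_ExI_same der_mono[OF assms]]) simp
qed (auto intro: der_asm)

section \<open>Kripke semantics of QS4.t\<close>

text \<open>Assignments range over the whole type \<open>'d\<close>, so a free variable may denote an object outside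
  the domain of the current world, whereas quantifiers range over that domain only.\<close>

locale tense_model =
  fixes W :: "'w set" and R :: "'w \<Rightarrow> 'w \<Rightarrow> bool" and D :: "'w \<Rightarrow> 'd set"
    and V :: "'w \<Rightarrow> nat \<Rightarrow> 'd list \<Rightarrow> bool"
  assumes R_refl: "w \<in> W \<Longrightarrow> R w w"
    and R_trans: "R u v \<Longrightarrow> R v w \<Longrightarrow> R u w"
    and D_nonempty: "w \<in> W \<Longrightarrow> D w \<noteq> {}"
    and D_mono: "R v w \<Longrightarrow> D v \<subseteq> D w"
begin

primrec tsat :: "(nat \<Rightarrow> 'w \<Rightarrow> bool) \<Rightarrow> tfm \<Rightarrow> 'w \<Rightarrow> bool" where
  "tsat U (TVar i) w = U i w"
| "tsat U TBot w = False"
| "tsat U (TImp a b) w = (tsat U a w \<longrightarrow> tsat U b w)"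
| "tsat U (TBoxF a) w = (\<forall>v\<in>W. R w v \<longrightarrow> tsat U a v)"
| "tsat U (TBoxP a) w = (\<forall>v\<in>W. R v w \<longrightarrow> tsat U a v)"

primrec qsat :: "qfm \<Rightarrow> 'w \<Rightarrow> (var \<Rightarrow> 'd) \<Rightarrow> bool" where
  "qsat QBot w \<sigma> = False"
| "qsat (QPred k xs) w \<sigma> = V w k (map \<sigma> xs)"
| "qsat (QImp A B) w \<sigma> = (qsat A w \<sigma> \<longrightarrow> qsat B w \<sigma>)"
| "qsat (QAll x A) w \<sigma> = (\<forall>d\<in>D w. qsat A w (\<sigma>(x := d)))"
| "qsat (QBoxF A) w \<sigma> = (\<forall>v\<in>W. R w v \<longrightarrow> qsat A v \<sigma>)"
| "qsat (QBoxP A) w \<sigma> = (\<forall>v\<in>W. R v w \<longrightarrow> qsat A v \<sigma>)"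

lemma tsat_pfm_to_tfm: "tsat U (pfm_to_tfm s p) w \<longleftrightarrow> peval (\<lambda>i. tsat U (s i) w) p"
  by (induction p) auto

lemma S4t_sound: "a \<in> S4t \<Longrightarrow> w \<in> W \<Longrightarrow> tsat U a w"
proof (induction arbitrary: w rule: S4t.induct)
  case (S4t_taut p s)
  then show ?case by (simp add: tsat_pfm_to_tfm classical_taut_def)
qed (simp_all, (blast intro: R_refl R_trans)+)

text \<open>Propositional and tense operators leave the assignment unchanged, so for fixed \<sigma>
  the substituted formulas act as propositional valuations.\<close>

lemma qsat_tfm_to_qfm: "qsat (tfm_to_qfm s a) w \<sigma> \<longleftrightarrow> tsat (\<lambda>i w. qsat (s i) w \<sigma>) a w"
  by (induction a arbitrary: w) auto

lemma qsat_cong: "(\<And>x. x \<in> qfv A \<Longrightarrow> \<sigma> x = \<tau> x) \<Longrightarrow> qsat A w \<sigma> \<longleftrightarrow> qsat A w \<tau>"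
proof (induction A arbitrary: w \<sigma> \<tau>)
  case (QPred k xs)
  then have "map \<sigma> xs = map \<tau> xs" by simp
  then show ?case by (simp only: qsat.simps)
next
  case (QImp A B)
  have "qsat A w \<sigma> \<longleftrightarrow> qsat A w \<tau>" "qsat B w \<sigma> \<longleftrightarrow> qsat B w \<tau>"
    using QImp.IH[of \<sigma> \<tau> w] QImp.prems by simp_all
  then show ?case by simp
next
  case (QAll x A)
  have "qsat A w (\<sigma>(x := d)) \<longleftrightarrow> qsat A w (\<tau>(x := d))" for d
    by (rule QAll.IH) (use QAll.prems in auto)
  then show ?case by simp
next
  case (QBoxF A)
  then have "qsat A v \<sigma> \<longleftrightarrow> qsat A v \<tau>" for v by (metis qfv.simps(5))
  then show ?case by simp
next
  case (QBoxP A)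
  then have "qsat A v \<sigma> \<longleftrightarrow> qsat A v \<tau>" for v by (metis qfv.simps(6))
  then show ?case by simp
qed simp

lemma qsat_upd_notin: "x \<notin> qfv A \<Longrightarrow> qsat A w (\<sigma>(x := d)) \<longleftrightarrow> qsat A w \<sigma>"
  by (rule qsat_cong) auto

lemma qsubst_notin_qfv: "x \<notin> qfv A \<Longrightarrow> qsubst y x A = A"
  by (induction A) (auto intro: map_idI)

lemma qsat_qsubst: "qfree_for y x A \<Longrightarrow> qsat (qsubst y x A) w \<sigma> \<longleftrightarrow> qsat A w (\<sigma>(x := \<sigma> y))"
proof (induction A arbitrary: w \<sigma>)
  case (QPred k xs)
  have "map \<sigma> (map (\<lambda>z. if z = x then y else z) xs) = map (\<sigma>(x := \<sigma> y)) xs"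
    by simp
  then show ?case by (simp only: qsat.simps qsubst.simps)
next
  case (QAll z A)
  show ?case
  proof (cases "x \<in> qfv (QAll z A)")
    case True
    then have "z \<noteq> y" "z \<noteq> x" "qfree_for y x A"
      using QAll.prems by auto
    moreover from this have "(\<sigma>(z := d))(x := (\<sigma>(z := d)) y) = (\<sigma>(x := \<sigma> y))(z := d)" for d
      by auto
    ultimately show ?thesis
      using QAll.IH by (simp del: fun_upd_apply)
  next
    case False
    then show ?thesis
      by (simp only: qsubst_notin_qfv qsat_upd_notin not_False_eq_True)
  qed
qed simp_all

lemma qsat_QAll_swap: "qsat (QAll x (QAll y A)) w \<sigma> \<longleftrightarrow> qsat (QAll y (QAll x A)) w \<sigma>"
proof (cases "x = y")
  case False
  then have "(\<sigma>(x := d))(y := e) = (\<sigma>(y := e))(x := d)" for d e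
    by auto
  then show ?thesis by (auto simp del: fun_upd_apply)
qed simp

text \<open>Domains matter at three schemes: the outer quantifier of instantiation puts the value of
  \<open>y\<close> into the domain, vacuous elimination uses a nonempty domain, and the converse
  Barcan formula uses growing domains.\<close>

lemma QS4t_sound: "A \<in> QS4t \<Longrightarrow> w \<in> W \<Longrightarrow> qsat A w \<sigma>"
proof (induction arbitrary: w \<sigma> rule: QS4t.induct)
  case (QS4t_S4t p s)
  then show ?case by (simp add: qsat_tfm_to_qfm S4t_sound)
next
  case (QS4t_UI y x A)
  then show ?case by (auto simp: qsat_qsubst)
next
  case QS4t_AllSwap
  then show ?case using qsat_QAll_swap by simp
next
  case (QS4t_VacI x A)
  then show ?case by (auto simp: qsat_upd_notin)
next
  case (QS4t_VacE x A)
  then show ?case using D_nonempty by (auto simp: qsat_upd_notin)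
next
  case (QS4t_CBF x A)
  then show ?case using D_mono by fastforce
qed auto

text \<open>Each quantifier is instantiated with the value \<sigma> already gives its variable, so
  the assignment does not change.\<close>

lemma qsat_QAllsD:
  "qsat (QAlls xs A) w \<sigma> \<Longrightarrow> (\<And>x. x \<in> set xs \<Longrightarrow> \<sigma> x \<in> D w) \<Longrightarrow> qsat A w \<sigma>"
  by (induction xs) (auto simp: QAlls_def dest!: bspec)

lemma qsat_persistent: "qsat (tense_trans A) v \<sigma> \<Longrightarrow> R v w \<Longrightarrow> w \<in> W \<Longrightarrow> qsat (tense_trans A) w \<sigma>"
  by (induction A arbitrary: \<sigma>) (simp_all, (blast intro: R_trans)+)

end

section \<open>Canonical renaming of bound variables\<close>

text \<open>Only nested quantifiers count. Since no free variable is consulted, the bound name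
  derived from the height is the same for every renaming.\<close>

primrec qheight :: "ifm \<Rightarrow> nat" where
  "qheight IBot = 0"
| "qheight (IPred k xs) = 0"
| "qheight (IAnd A B) = max (qheight A) (qheight B)"
| "qheight (IOr A B) = max (qheight A) (qheight B)"
| "qheight (IImp A B) = max (qheight A) (qheight B)"
| "qheight (IAll x A) = Suc (qheight A)"
| "qheight (IEx x A) = Suc (qheight A)"

text \<open>Instances \<open>rename \<sigma> A\<close> play the role of formulas with parameters from \<open>Par\<close>. Naming the bound
  variable of a quantifier after the height of its body makes renaming commute with instantiation of
  quantifiers as a syntactic identity (\<open>isubst_rename_upd\<close>), without any appeal to
  alpha-equivalence.\<close>

locale parameters =
  fixes Par :: "var set" and bnd :: "nat \<Rightarrow> var"
  assumes infinite_Par: "infinite Par"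
    and inj_bnd: "inj bnd"
    and bnd_notin_Par: "bnd n \<notin> Par"
begin

primrec rename :: "(var \<Rightarrow> var) \<Rightarrow> ifm \<Rightarrow> ifm" where
  "rename \<sigma> IBot = IBot"
| "rename \<sigma> (IPred k xs) = IPred k (map \<sigma> xs)"
| "rename \<sigma> (IAnd A B) = IAnd (rename \<sigma> A) (rename \<sigma> B)"
| "rename \<sigma> (IOr A B) = IOr (rename \<sigma> A) (rename \<sigma> B)"
| "rename \<sigma> (IImp A B) = IImp (rename \<sigma> A) (rename \<sigma> B)"
| "rename \<sigma> (IAll x A) = IAll (bnd (qheight A)) (rename (\<sigma>(x := bnd (qheight A))) A)"
| "rename \<sigma> (IEx x A) = IEx (bnd (qheight A)) (rename (\<sigma>(x := bnd (qheight A))) A)"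

lemma rename_cong: "(\<And>x. x \<in> ifv A \<Longrightarrow> \<sigma> x = \<tau> x) \<Longrightarrow> rename \<sigma> A = rename \<tau> A"
proof (induction A arbitrary: \<sigma> \<tau>)
  case (IAll x A)
  have "rename (\<sigma>(x := d)) A = rename (\<tau>(x := d)) A" for d
    by (rule IAll.IH) (use IAll.prems in auto)
  then show ?case by simp
next
  case (IEx x A)
  have "rename (\<sigma>(x := d)) A = rename (\<tau>(x := d)) A" for d
    by (rule IEx.IH) (use IEx.prems in auto)
  then show ?case by simp
next
  case (IAnd A B)
  show ?case using IAnd.IH[of \<sigma> \<tau>] IAnd.prems by simp
next
  case (IOr A B)
  show ?case using IOr.IH[of \<sigma> \<tau>] IOr.prems by simp
next
  case (IImp A B)
  show ?case using IImp.IH[of \<sigma> \<tau>] IImp.prems by simp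
qed simp_all

text \<open>Names inside a body have smaller indices than its height, so the binder named after that
  height cannot recur below itself.\<close>

lemma ibv_rename: "ibv (rename \<sigma> A) \<subseteq> bnd ` {..<qheight A}"
proof (induction A arbitrary: \<sigma>)
  case (IAll x A)
  then show ?case by (fastforce simp: less_Suc_eq)
next
  case (IEx x A)
  then show ?case by (fastforce simp: less_Suc_eq)
qed (simp_all, fastforce+)

lemma Par_notin_ibv_rename: "y \<in> Par \<Longrightarrow> y \<notin> ibv (rename \<sigma> A)"
  using ibv_rename[of \<sigma> A] bnd_notin_Par by auto

lemma bnd_qheight_notin_ibv_rename: "bnd (qheight A) \<notin> ibv (rename \<sigma> A)"
  using ibv_rename[of \<sigma> A] inj_bnd by (auto dest: injD)

lemma ifv_rename: "ifv (rename \<sigma> A) \<subseteq> \<sigma> ` ifv A"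
proof (induction A arbitrary: \<sigma>)
  case (IAll x A)
  have "(\<sigma>(x := bnd (qheight A))) ` ifv A - {bnd (qheight A)} \<subseteq> \<sigma> ` (ifv A - {x})"
    by auto
  then show ?case using IAll[of "\<sigma>(x := bnd (qheight A))"] by (auto simp del: fun_upd_apply)
next
  case (IEx x A)
  have "(\<sigma>(x := bnd (qheight A))) ` ifv A - {bnd (qheight A)} \<subseteq> \<sigma> ` (ifv A - {x})"
    by auto
  then show ?case using IEx[of "\<sigma>(x := bnd (qheight A))"] by (auto simp del: fun_upd_apply)
qed (simp_all, fastforce+)

lemma isubst_rename:
  "z \<notin> ibv (rename \<sigma> A) \<Longrightarrow> isubst d z (rename \<sigma> A) = rename (\<lambda>x. if \<sigma> x = z then d else \<sigma> x) A"
proof (induction A arbitrary: \<sigma>)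
  case (IAll y A)
  let ?b = "bnd (qheight A)"
  have "isubst d z (rename (\<sigma>(y := ?b)) A)
      = rename (\<lambda>x. if (\<sigma>(y := ?b)) x = z then d else (\<sigma>(y := ?b)) x) A"
    using IAll.IH[of "\<sigma>(y := ?b)"] IAll.prems by (simp del: fun_upd_apply)
  \<comment> \<open>The name \<open>?b\<close> is bound in the renamed formula, so it differs from
    \<open>z\<close> and the substitution leaves it alone.\<close>
  also have "\<dots> = rename ((\<lambda>x. if \<sigma> x = z then d else \<sigma> x)(y := ?b)) A"
    by (rule rename_cong) (use IAll.prems in auto)
  finally show ?case using IAll.prems by (simp del: fun_upd_apply)
next
  case (IEx y A)
  let ?b = "bnd (qheight A)"
  have "isubst d z (rename (\<sigma>(y := ?b)) A)
      = rename (\<lambda>x. if (\<sigma>(y := ?b)) x = z then d else (\<sigma>(y := ?b)) x) A"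
    using IEx.IH[of "\<sigma>(y := ?b)"] IEx.prems by (simp del: fun_upd_apply)
  also have "\<dots> = rename ((\<lambda>x. if \<sigma> x = z then d else \<sigma> x)(y := ?b)) A"
    by (rule rename_cong) (use IEx.prems in auto)
  finally show ?case using IEx.prems by (simp del: fun_upd_apply)
qed auto

lemma isubst_rename_upd:
  assumes "range \<sigma> \<subseteq> Par"
  shows "isubst d (bnd (qheight A)) (rename (\<sigma>(x := bnd (qheight A))) A) = rename (\<sigma>(x := d)) A"
proof -
  have "\<sigma> y \<noteq> bnd n" for y n
    using assms bnd_notin_Par by (metis rangeI subsetD)
  then show ?thesis
    unfolding isubst_rename[OF bnd_qheight_notin_ibv_rename]
    by (intro rename_cong) auto
qed

lemma isubst_rename_bnd:
  assumes "insert x (ifv A \<union> ibv A) \<subseteq> Par" "\<And>y. y \<in> insert x (ifv A \<union> ibv A) \<Longrightarrow> \<sigma> y = y"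
  shows "isubst (bnd n) x (rename \<sigma> A) = rename (\<sigma>(x := bnd n)) A"
proof -
  have "isubst (bnd n) x (rename \<sigma> A) = rename (\<lambda>y. if \<sigma> y = x then bnd n else \<sigma> y) A"
    using assms(1) by (intro isubst_rename Par_notin_ibv_rename) auto
  also have "\<dots> = rename (\<sigma>(x := bnd n)) A"
    using assms(2) by (intro rename_cong) auto
  finally show ?thesis .
qed

text \<open>When \<sigma> fixes the variables of \<open>A\<close>, the renamed formula is an
  alpha-variant. The bound variables of \<open>A\<close> must also be parameters, so that the new
  names are fresh for it.\<close>

lemma der_rename:
  assumes "ifv A \<union> ibv A \<subseteq> Par" "\<And>x. x \<in> ifv A \<union> ibv A \<Longrightarrow> \<sigma> x = x"
  shows "der {A} (rename \<sigma> A) \<and> der {rename \<sigma> A} A"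
  using assms
proof (induction A)
  case IBot
  then show ?case by (auto intro: der_asm)
next
  case (IPred k xs)
  then show ?case by (auto intro: der_asm simp: map_idI)
next
  case (IAnd A B)
  then show ?case by (auto intro: der_And_mono)
next
  case (IOr A B)
  then show ?case by (auto intro: der_Or_mono)
next
  case (IImp A B)
  then show ?case by (auto intro: der_Imp_mono)
next
  case (IAll x A)
  have vars: "insert x (ifv A \<union> ibv A) \<subseteq> Par" "\<And>y. y \<in> insert x (ifv A \<union> ibv A) \<Longrightarrow> \<sigma> y = y"
    using IAll.prems by auto
  then have *: "bnd (qheight A) \<notin> ifv (rename \<sigma> A)"
    using ifv_rename[of \<sigma> A] bnd_notin_Par by (metis (no_types, opaque_lifting) UnI1 imageE insertCI subset_iff)
  have IH: "der {A} (rename \<sigma> A)" "der {rename \<sigma> A} A"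
    using IAll.IH vars by auto
  have "isubst (bnd (qheight A)) x (rename \<sigma> A) = rename (\<sigma>(x := bnd (qheight A))) A"
    using vars by (rule isubst_rename_bnd)
  \<comment> \<open>The binder changes only after the body has been renamed under the old one, so
    the derived renaming of a single binder is enough.\<close>
  note rename = der_All_rename[OF * bnd_qheight_notin_ibv_rename, of x, unfolded this]
  show ?case
    using der_trans[OF der_All_mono[OF IH(1)] rename(1)] der_trans[OF rename(2) der_All_mono[OF IH(2)]]
    by simp
next
  case (IEx x A)
  have vars: "insert x (ifv A \<union> ibv A) \<subseteq> Par" "\<And>y. y \<in> insert x (ifv A \<union> ibv A) \<Longrightarrow> \<sigma> y = y"
    using IEx.prems by auto
  then have *: "bnd (qheight A) \<notin> ifv (rename \<sigma> A)"
    using ifv_rename[of \<sigma> A] bnd_notin_Par by (metis (no_types, opaque_lifting) UnI1 imageE insertCI subset_iff)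
  have IH: "der {A} (rename \<sigma> A)" "der {rename \<sigma> A} A"
    using IEx.IH vars by auto
  have "isubst (bnd (qheight A)) x (rename \<sigma> A) = rename (\<sigma>(x := bnd (qheight A))) A"
    using vars by (rule isubst_rename_bnd)
  note rename = der_Ex_rename[OF * bnd_qheight_notin_ibv_rename, of x, unfolded this]
  show ?case
    using der_trans[OF der_Ex_mono[OF IH(1)] rename(1)] der_trans[OF rename(2) der_Ex_mono[OF IH(2)]]
    by simp
qed

end

section \<open>Prime extensions and the canonical model\<close>

definition prime_theory :: "ifm set \<Rightarrow> var set \<Rightarrow> bool" where
  "prime_theory T D \<longleftrightarrow> (\<forall>A\<in>T. ifv A \<subseteq> D) \<and> IBot \<notin> T \<and> (\<forall>A. ifv A \<subseteq> D \<longrightarrow> der T A \<longrightarrow> A \<in> T) \<and>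
    (\<forall>A B. IOr A B \<in> T \<longrightarrow> A \<in> T \<or> B \<in> T) \<and>
    (\<forall>x A. IEx x A \<in> T \<longrightarrow> (\<exists>d\<in>D. isubst d x A \<in> T))"

lemma prime_theoryD:
  assumes "prime_theory T D"
  shows prime_theory_ifv: "A \<in> T \<Longrightarrow> ifv A \<subseteq> D"
    and prime_theory_IBot: "IBot \<notin> T"
    and prime_theory_closed: "ifv A \<subseteq> D \<Longrightarrow> der T A \<Longrightarrow> A \<in> T"
    and prime_theory_IOr: "IOr A B \<in> T \<Longrightarrow> A \<in> T \<or> B \<in> T"
    and prime_theory_IEx: "IEx x A \<in> T \<Longrightarrow> \<exists>d\<in>D. isubst d x A \<in> T"
  using assms unfolding prime_theory_def by blast+

lemma prime_theory_IQC_MP: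
  "prime_theory T D \<Longrightarrow> IImp A B \<in> IQC \<Longrightarrow> A \<in> T \<Longrightarrow> ifv B \<subseteq> D \<Longrightarrow> B \<in> T"
  by (rule prime_theory_closed) (auto intro: der_IQC_MP der_asm)

lemma prime_theory_IAnd_iff:
  assumes "prime_theory T D" "ifv A \<subseteq> D" "ifv B \<subseteq> D"
  shows "IAnd A B \<in> T \<longleftrightarrow> A \<in> T \<and> B \<in> T"
proof
  show "IAnd A B \<in> T \<Longrightarrow> A \<in> T \<and> B \<in> T"
    using assms prime_theory_IQC_MP IQC_AndE1 IQC_AndE2 by metis
  show "A \<in> T \<and> B \<in> T \<Longrightarrow> IAnd A B \<in> T"
    using assms by (intro prime_theory_closed[OF assms(1)]) (auto intro: der_AndI der_asm)
qed

lemma prime_theory_IOr_iff: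
  assumes "prime_theory T D" "ifv A \<subseteq> D" "ifv B \<subseteq> D"
  shows "IOr A B \<in> T \<longleftrightarrow> A \<in> T \<or> B \<in> T"
  using prime_theory_IQC_MP[OF assms(1) IQC_OrI1, of A B]
    prime_theory_IQC_MP[OF assms(1) IQC_OrI2, of B A] prime_theory_IOr[OF assms(1)] assms
  by auto

text \<open>If a fresh witness led to \<open>C\<close>, existential elimination would already derive
  \<open>C\<close> from the existential formula.\<close>

lemma not_der_insert_witness:
  assumes "\<not> der (insert A S) C" "A = IEx x B"
    and d: "d \<notin> ifv B" "d \<notin> ibv B" "d \<notin> ifv C" "\<And>F. F \<in> S \<Longrightarrow> d \<notin> ifv F"
  shows "\<not> der (insert (isubst d x B) (insert A S)) C"
proof
  assume *: "der (insert (isubst d x B) (insert A S)) C"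
  have "der (insert A S) (IEx d (isubst d x B))"
    unfolding assms(2) by (rule der_mono[OF der_Ex_rename(1)[OF d(1,2)]]) auto
  then have "der (insert A S) C"
    using assms(2) d by (intro der_Ex_elim[OF *, of d]) auto
  then show False using assms(1) by blast
qed

text \<open>Only finitely many formulas are ever added to \<open>G\<close>, and \<open>G\<close>
  itself uses no variable of \<open>Y\<close>; so a fresh witness in \<open>Y\<close> always exists,
  even when \<open>G\<close> is infinite.\<close>

lemma prime_extension_step:
  assumes "infinite Y" "Y \<inter> D0 = {}" "\<And>F. F \<in> G \<Longrightarrow> ifv F \<subseteq> D0"
    and S: "G \<subseteq> S" "finite (S - G)" "\<And>F. F \<in> S \<Longrightarrow> ifv F \<subseteq> D0 \<union> Y" "\<not> der S C"
  shows "\<exists>S'. (G \<subseteq> S' \<and> finite (S' - G) \<and> (\<forall>F\<in>S'. ifv F \<subseteq> D0 \<union> Y) \<and> \<not> der S' C) \<and> S \<subseteq> S' \<and>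
    (ifv A \<subseteq> D0 \<union> Y \<longrightarrow> \<not> der (insert A S) C \<longrightarrow>
      A \<in> S' \<and> (\<forall>x B. A = IEx x B \<longrightarrow> (\<exists>d\<in>D0 \<union> Y. isubst d x B \<in> S')))"
proof (cases "ifv A \<subseteq> D0 \<union> Y \<and> \<not> der (insert A S) C")
  case False
  then show ?thesis using S by (intro exI[of _ S]) auto
next
  case True
  have fin: "finite (insert A S - G)"
    using S(2) by (rule finite_subset[rotated, OF finite.insertI[of _ A]]) auto
  show ?thesis
  proof (cases "\<exists>x B. A = IEx x B")
    case False
    then show ?thesis using S True fin by (intro exI[of _ "insert A S"]) auto
  next
    case ex: True
    then obtain x B where A: "A = IEx x B" by blast
    have "finite (ifv B \<union> ibv B \<union> ifv C \<union> (\<Union>F\<in>S - G. ifv F))"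
      using S(2) by simp
    then obtain d where d: "d \<in> Y" "d \<notin> ifv B \<union> ibv B \<union> ifv C \<union> (\<Union>F\<in>S - G. ifv F)"
      using assms(1) by (metis finite_subset subsetI)
    have "d \<notin> ifv F" if "F \<in> S" for F
      using that d assms(2,3) by (cases "F \<in> G") blast+
    then have "\<not> der (insert (isubst d x B) (insert A S)) C"
      using True d A by (intro not_der_insert_witness) auto
    moreover have "ifv (isubst d x B) \<subseteq> D0 \<union> Y"
      using True A d(1) ifv_isubst_subset[of d x B] by auto
    moreover have "finite (insert (isubst d x B) (insert A S) - G)"
      using fin by (rule finite_subset[rotated, OF finite.insertI[of _ "isubst d x B"]]) auto
    ultimately show ?thesis
      using S True A d(1) by (intro exI[of _ "insert (isubst d x B) (insert A S)"]) auto
  qed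
qed

text \<open>Lindenbaum and Henkin in one run: a formula over the domain is rejected only if adding
  it would derive \<open>C\<close>. If both disjuncts of a member were rejected, the disjunction
  would derive \<open>C\<close>, which gives primeness.\<close>

lemma prime_extension:
  assumes "infinite Y" "Y \<inter> D0 = {}" "\<And>F. F \<in> G \<Longrightarrow> ifv F \<subseteq> D0" "\<not> der G C" "ifv C \<subseteq> D0"
  obtains T where "prime_theory T (D0 \<union> Y)" "G \<subseteq> T" "C \<notin> T"
proof -
  let ?D = "D0 \<union> Y"
  \<comment> \<open>\<open>?P\<close> is the invariant of a stage; \<open>?Q\<close> says that stage
    \<open>n\<close> settles the formula with number \<open>n\<close>.\<close>
  let ?P = "\<lambda>(n::nat) S. G \<subseteq> S \<and> finite (S - G) \<and> (\<forall>F\<in>S. ifv F \<subseteq> ?D) \<and> \<not> der S C"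
  let ?Q = "\<lambda>n S S'. S \<subseteq> S' \<and> (ifv (from_nat n) \<subseteq> ?D \<longrightarrow> \<not> der (insert (from_nat n) S) C \<longrightarrow>
      from_nat n \<in> S' \<and> (\<forall>x B. from_nat n = IEx x B \<longrightarrow> (\<exists>d\<in>?D. isubst d x B \<in> S')))"
  have "\<exists>f. \<forall>n. ?P n (f n) \<and> ?Q n (f n) (f (Suc n))"
  proof (rule dependent_nat_choice)
    show "\<exists>S. ?P 0 S"
      using assms(3,4) by (intro exI[of _ G]) auto
    show "\<exists>S'. ?P (Suc n) S' \<and> ?Q n S S'" if "?P n S" for S n
      using that by (intro prime_extension_step[OF assms(1,2,3)]) auto
  qed
  then obtain f where f: "\<forall>n. ?P n (f n) \<and> ?Q n (f n) (f (Suc n))"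
    by (rule exE)
  have f_G: "G \<subseteq> f n" and f_fv: "\<forall>F\<in>f n. ifv F \<subseteq> ?D" and f_C: "\<not> der (f n) C" for n
    using f[THEN spec, THEN conjunct1, of n] by simp_all
  have f_Suc: "f n \<subseteq> f (Suc n)" for n
    using f[THEN spec, THEN conjunct2, of n] by simp
  have f_step: "F \<in> f (Suc (to_nat F)) \<and>
      (\<forall>x B. F = IEx x B \<longrightarrow> (\<exists>d\<in>?D. isubst d x B \<in> f (Suc (to_nat F))))"
    if "ifv F \<subseteq> ?D" "\<not> der (insert F (f (to_nat F))) C" for F
    using f[THEN spec, THEN conjunct2, of "to_nat F"] that by simp
  define T where "T = (\<Union>n. f n)"
  have mono: "f m \<subseteq> f n" if "m \<le> n" for m n
    using f_Suc that by (rule lift_Suc_mono_le)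
  have der_T: "\<exists>n. der (f n) F" if "der T F" for F
    using that
  proof (induction rule: der.induct)
    case (der_MP A B)
    then obtain m n where "der (f m) A" "der (f n) (IImp A B)" by blast
    then have "der (f (max m n)) A" "der (f (max m n)) (IImp A B)"
      by (simp_all add: der_mono[OF _ mono])
    then show ?case using der.der_MP by blast
  qed (auto simp: T_def intro: der.intros)
  have T_C: "\<not> der T C"
    using der_T f_C by blast
  have T_fv: "ifv F \<subseteq> ?D" if "F \<in> T" for F
    using that f_fv by (auto simp: T_def)
  have max: "F \<in> T \<and> (\<forall>x B. F = IEx x B \<longrightarrow> (\<exists>d\<in>?D. isubst d x B \<in> T))"
    if "ifv F \<subseteq> ?D" "\<not> der (insert F T) C" for F
  proof -
    have "\<not> der (insert F (f (to_nat F))) C"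
      using that(2) der_mono[of "insert F (f (to_nat F))" C "insert F T"] by (auto simp: T_def)
    then show ?thesis
      using f_step[OF that(1)] unfolding T_def by blast
  qed
  have T_asm: "\<not> der (insert F T) C" if "F \<in> T" for F
    using that T_C by (simp add: insert_absorb)
  show thesis
  proof
    show "G \<subseteq> T" using f_G by (auto simp: T_def)
    show "C \<notin> T" using T_C der_asm by blast
    show "prime_theory T ?D"
      unfolding prime_theory_def
    proof (intro conjI allI impI ballI)
      show "ifv A \<subseteq> ?D" if "A \<in> T" for A
        using that by (rule T_fv)
      show "IBot \<notin> T"
        using T_C IQC_BotE der_IQC_MP der_asm by blast
      show "A \<in> T" if "ifv A \<subseteq> ?D" "der T A" for A
        using max[OF that(1)] der_cut[OF that(2)] T_C by blast
      show "A \<in> T \<or> B \<in> T" if "IOr A B \<in> T" for A B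
      proof (rule ccontr)
        assume "\<not> (A \<in> T \<or> B \<in> T)"
        then have "der (insert A T) C" "der (insert B T) C"
          using max[of A] max[of B] T_fv[OF that] by auto
        then show False
          using T_C der_OrE der_asm[OF that] by blast
      qed
      show "\<exists>d\<in>?D. isubst d x A \<in> T" if "IEx x A \<in> T" for x A
        using max[OF T_fv[OF that] T_asm[OF that]] by blast
    qed
  qed
qed

section \<open>The canonical Kripke model\<close>

context parameters
begin

text \<open>Co-infinity of the domain leaves room for fresh parameters in later worlds.\<close>

definition worlds :: "(ifm set \<times> var set) set" where
  "worlds = {(T, D). prime_theory T D \<and> D \<noteq> {} \<and> D \<subseteq> Par \<and> infinite (Par - D)}"

lemma worlds_extension:
  assumes "D0 \<subseteq> Par" "infinite (Par - D0)" "\<And>F. F \<in> G \<Longrightarrow> ifv F \<subseteq> D0" "\<not> der G C" "ifv C \<subseteq> D0"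
  obtains T D where "(T, D) \<in> worlds" "G \<subseteq> T" "D0 \<subseteq> D" "C \<notin> T"
proof -
  obtain Y Z where YZ: "Y \<subseteq> Par - D0" "Z \<subseteq> Par - D0" "infinite Y" "infinite Z" "Y \<inter> Z = {}"
    using infinite_split[OF assms(2)] by blast
  then have disj: "Y \<inter> D0 = {}" by blast
  obtain T where T: "prime_theory T (D0 \<union> Y)" "G \<subseteq> T" "C \<notin> T"
    using prime_extension[OF YZ(3) disj assms(3-5)] by blast
  have "Z \<subseteq> Par - (D0 \<union> Y)"
    using YZ by blast
  then have "infinite (Par - (D0 \<union> Y))"
    using YZ(4) finite_subset by blast
  moreover have "Y \<noteq> {}"
    using YZ(3) by auto
  ultimately have "(T, D0 \<union> Y) \<in> worlds"
    using T(1) YZ(1) assms(1) by (auto simp: worlds_def)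
  then show thesis
    using T(2,3) by (intro that) auto
qed

sublocale canonical: tense_model worlds "\<lambda>v w. fst v \<subseteq> fst w \<and> snd v \<subseteq> snd w" snd
    "\<lambda>w k xs. IPred k xs \<in> fst w"
  by unfold_locales (auto simp: worlds_def)

lemma worlds_IImp_iff:
  assumes "(T, D) \<in> worlds" "ifv A \<subseteq> D" "ifv B \<subseteq> D"
  shows "IImp A B \<in> T \<longleftrightarrow> (\<forall>(T', D')\<in>worlds. T \<subseteq> T' \<longrightarrow> D \<subseteq> D' \<longrightarrow> A \<in> T' \<longrightarrow> B \<in> T')"
proof
  have T: "prime_theory T D" "D \<subseteq> Par" "infinite (Par - D)"
    using assms(1) by (auto simp: worlds_def)
  show "IImp A B \<in> T" if *: "\<forall>(T', D')\<in>worlds. T \<subseteq> T' \<longrightarrow> D \<subseteq> D' \<longrightarrow> A \<in> T' \<longrightarrow> B \<in> T'"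
  proof (rule ccontr)
    assume "IImp A B \<notin> T"
    then have "\<not> der (insert A T) B"
      using prime_theory_closed[OF T(1), of "IImp A B"] assms by (auto simp: der_deduction_iff)
    moreover have "ifv F \<subseteq> D" if "F \<in> insert A T" for F
      using that assms(2) prime_theory_ifv[OF T(1)] by auto
    ultimately obtain T' D' where "(T', D') \<in> worlds" "insert A T \<subseteq> T'" "D \<subseteq> D'" "B \<notin> T'"
      using worlds_extension[OF T(2,3), of "insert A T" B] assms(3) by metis
    then show False using * by blast
  qed
  have "B \<in> T'" if "IImp A B \<in> T" "(T', D') \<in> worlds" "T \<subseteq> T'" "D \<subseteq> D'" "A \<in> T'" for T' D'
  proof (rule prime_theory_closed[of T' D'])
    show "der T' B"
      using that by (intro der_MP[of T' A B] der_asm) auto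
  qed (use that assms(3) in \<open>auto simp: worlds_def\<close>)
  then show "\<forall>(T', D')\<in>worlds. T \<subseteq> T' \<longrightarrow> D \<subseteq> D' \<longrightarrow> A \<in> T' \<longrightarrow> B \<in> T'" if "IImp A B \<in> T"
    using that by blast
qed

text \<open>If the universal formula is missing, a parameter outside \<open>D\<close> is a generic
  counterexample: deriving its instance would allow generalization. A world over the enlarged domain
  omits that instance.\<close>

lemma worlds_IAll_iff:
  assumes "(T, D) \<in> worlds" "ifv (IAll z B) \<subseteq> D" "z \<notin> Par" "ibv B \<inter> Par = {}"
  shows "IAll z B \<in> T \<longleftrightarrow>
    (\<forall>(T', D')\<in>worlds. T \<subseteq> T' \<longrightarrow> D \<subseteq> D' \<longrightarrow> (\<forall>d\<in>D'. isubst d z B \<in> T'))"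
proof
  have T: "prime_theory T D" "D \<subseteq> Par" "infinite (Par - D)"
    using assms(1) by (auto simp: worlds_def)
  show "IAll z B \<in> T"
    if *: "\<forall>(T', D')\<in>worlds. T \<subseteq> T' \<longrightarrow> D \<subseteq> D' \<longrightarrow> (\<forall>d\<in>D'. isubst d z B \<in> T')"
  proof (rule ccontr)
    assume notin: "IAll z B \<notin> T"
    obtain c where c: "c \<in> Par" "c \<notin> D"
      using T(3) by (metis DiffD1 DiffD2 all_not_in_conv finite.emptyI)
    then have fresh: "c \<notin> ifv B" "c \<notin> ibv B"
      using assms(2,3,4) by auto
    have "\<not> der T (isubst c z B)"
    proof
      assume "der T (isubst c z B)"
      then have "der T (IAll c (isubst c z B))"
        using prime_theory_ifv[OF T(1)] c(2) by (intro der_Gen) auto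
      then have "der T (IAll z B)"
        by (rule der_trans[OF _ der_All_rename(2)[OF fresh]])
      then show False
        using notin prime_theory_closed[OF T(1) assms(2)] by blast
    qed
    moreover have "Par - insert c D = (Par - D) - {c}"
      by blast
    then have "infinite (Par - insert c D)"
      using T(3) by simp
    moreover have "ifv (isubst c z B) \<subseteq> insert c D"
      using ifv_isubst_subset[of c z B] assms(2) by auto
    moreover have "insert c D \<subseteq> Par"
      using T(2) c(1) by blast
    moreover have "ifv F \<subseteq> insert c D" if "F \<in> T" for F
      using prime_theory_ifv[OF T(1) that] by blast
    ultimately obtain T' D'
      where "(T', D') \<in> worlds" "T \<subseteq> T'" "insert c D \<subseteq> D'" "isubst c z B \<notin> T'"
      using worlds_extension[of "insert c D" T "isubst c z B"] by blast
    then show False using * by blast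
  qed
  have "isubst d z B \<in> T'" if "IAll z B \<in> T" "(T', D') \<in> worlds" "T \<subseteq> T'" "D \<subseteq> D'" "d \<in> D'" for T' D' d
  proof (rule prime_theory_IQC_MP[OF _ IQC_AllE])
    show "ifree_for d z B"
      using that assms(4) by (intro ifree_for_notin_ibv) (auto simp: worlds_def)
    show "ifv (isubst d z B) \<subseteq> D'"
      using ifv_isubst_subset[of d z B] assms(2) that by auto
  qed (use that in \<open>auto simp: worlds_def\<close>)
  then show "\<forall>(T', D')\<in>worlds. T \<subseteq> T' \<longrightarrow> D \<subseteq> D' \<longrightarrow> (\<forall>d\<in>D'. isubst d z B \<in> T')" if "IAll z B \<in> T"
    using that by blast
qed

lemma worlds_IEx_iff:
  assumes "(T, D) \<in> worlds" "ifv (IEx z B) \<subseteq> D" "ibv B \<inter> Par = {}"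
  shows "IEx z B \<in> T \<longleftrightarrow> (\<exists>d\<in>D. isubst d z B \<in> T)"
proof
  have T: "prime_theory T D" "D \<subseteq> Par"
    using assms(1) by (auto simp: worlds_def)
  show "IEx z B \<in> T \<Longrightarrow> \<exists>d\<in>D. isubst d z B \<in> T"
    by (rule prime_theory_IEx[OF T(1)])
  show "\<exists>d\<in>D. isubst d z B \<in> T \<Longrightarrow> IEx z B \<in> T"
    using T(2) assms(2,3) prime_theory_IQC_MP[OF T(1) IQC_ExI[OF ifree_for_notin_ibv]] by blast
qed

lemma ibv_rename_disjoint: "ibv (rename \<sigma> A) \<inter> Par = {}"
  using Par_notin_ibv_rename by blast

lemma worlds_prime_theory: "w \<in> worlds \<Longrightarrow> prime_theory (fst w) (snd w)"
  by (auto simp: worlds_def)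

text \<open>All values of \<sigma> are parameters, which keeps them apart from the bound names. Only
  the values at free variables need to exist at \<open>w\<close>, so \<sigma> can stay the same when
  moving to a future world.\<close>

lemma canonical_truth:
  assumes "w \<in> worlds" "range \<sigma> \<subseteq> Par" "\<sigma> ` ifv A \<subseteq> snd w"
  shows "canonical.qsat (tense_trans A) w \<sigma> \<longleftrightarrow> rename \<sigma> A \<in> fst w"
  using assms
proof (induction A arbitrary: w \<sigma>)
  case IBot
  then show ?case
    using prime_theory_IBot[OF worlds_prime_theory] by simp
next
  case (IPred k xs)
  then show ?case by auto
next
  case (IAnd A B)
  have "ifv (rename \<sigma> A) \<subseteq> snd w" "ifv (rename \<sigma> B) \<subseteq> snd w"
    using ifv_rename[of \<sigma> A] ifv_rename[of \<sigma> B] IAnd.prems(3) by (auto simp: image_Un)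
  then have "IAnd (rename \<sigma> A) (rename \<sigma> B) \<in> fst w \<longleftrightarrow> rename \<sigma> A \<in> fst w \<and> rename \<sigma> B \<in> fst w"
    by (rule prime_theory_IAnd_iff[OF worlds_prime_theory[OF IAnd.prems(1)]])
  moreover have "canonical.qsat (tense_trans A) w \<sigma> \<longleftrightarrow> rename \<sigma> A \<in> fst w"
    "canonical.qsat (tense_trans B) w \<sigma> \<longleftrightarrow> rename \<sigma> B \<in> fst w"
    using IAnd.IH[OF IAnd.prems(1,2)] IAnd.prems(3) by (simp_all add: image_Un)
  ultimately show ?case by auto
next
  case (IOr A B)
  have "ifv (rename \<sigma> A) \<subseteq> snd w" "ifv (rename \<sigma> B) \<subseteq> snd w"
    using ifv_rename[of \<sigma> A] ifv_rename[of \<sigma> B] IOr.prems(3) by (auto simp: image_Un)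
  then have "IOr (rename \<sigma> A) (rename \<sigma> B) \<in> fst w \<longleftrightarrow> rename \<sigma> A \<in> fst w \<or> rename \<sigma> B \<in> fst w"
    by (rule prime_theory_IOr_iff[OF worlds_prime_theory[OF IOr.prems(1)]])
  moreover have "canonical.qsat (tense_trans A) w \<sigma> \<longleftrightarrow> rename \<sigma> A \<in> fst w"
    "canonical.qsat (tense_trans B) w \<sigma> \<longleftrightarrow> rename \<sigma> B \<in> fst w"
    using IOr.IH[OF IOr.prems(1,2)] IOr.prems(3) by (simp_all add: image_Un)
  ultimately show ?case by auto
next
  case (IImp A B)
  obtain T D where w: "w = (T, D)" by fastforce
  have fv: "\<sigma> ` ifv A \<subseteq> D" "\<sigma> ` ifv B \<subseteq> D"
    using IImp.prems(3) w by auto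
  then have "ifv (rename \<sigma> A) \<subseteq> D" "ifv (rename \<sigma> B) \<subseteq> D"
    using ifv_rename[of \<sigma> A] ifv_rename[of \<sigma> B] by auto
  note iff = worlds_IImp_iff[OF IImp.prems(1)[unfolded w] this, unfolded case_prod_beta]
  have "canonical.qsat (tense_trans A) v \<sigma> \<longleftrightarrow> rename \<sigma> A \<in> fst v"
    "canonical.qsat (tense_trans B) v \<sigma> \<longleftrightarrow> rename \<sigma> B \<in> fst v"
    if "v \<in> worlds" "D \<subseteq> snd v" for v
    using IImp.IH[OF that(1) IImp.prems(2)] fv that(2) by auto
  then show ?case by (auto simp: iff w)
next
  case (IAll x A)
  obtain T D where w: "w = (T, D)" by fastforce
  have fv: "\<sigma> ` (ifv A - {x}) \<subseteq> D"
    using IAll.prems(3) w by auto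
  have "ifv (rename \<sigma> (IAll x A)) \<subseteq> D"
    using ifv_rename[of \<sigma> "IAll x A"] fv by auto
  note iff = worlds_IAll_iff[OF IAll.prems(1)[unfolded w] this[unfolded rename.simps]
      bnd_notin_Par ibv_rename_disjoint, unfolded isubst_rename_upd[OF IAll.prems(2)] case_prod_beta]
  have "canonical.qsat (tense_trans A) v (\<sigma>(x := d)) \<longleftrightarrow> rename (\<sigma>(x := d)) A \<in> fst v"
    if "v \<in> worlds" "D \<subseteq> snd v" "d \<in> snd v" for v d
  proof (rule IAll.IH)
    show "v \<in> worlds" by fact
    have "d \<in> Par" using that by (auto simp: worlds_def)
    then show "range (\<sigma>(x := d)) \<subseteq> Par" using IAll.prems(2) by auto
    show "(\<sigma>(x := d)) ` ifv A \<subseteq> snd v" using fv that by auto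
  qed
  then show ?case by (auto simp: iff w simp del: fun_upd_apply)
next
  case (IEx x A)
  obtain T D where w: "w = (T, D)" by fastforce
  have fv: "\<sigma> ` (ifv A - {x}) \<subseteq> D"
    using IEx.prems(3) w by auto
  have "ifv (rename \<sigma> (IEx x A)) \<subseteq> D"
    using ifv_rename[of \<sigma> "IEx x A"] fv by auto
  note iff = worlds_IEx_iff[OF IEx.prems(1)[unfolded w] this[unfolded rename.simps]
      ibv_rename_disjoint, unfolded isubst_rename_upd[OF IEx.prems(2)]]
  have IH: "canonical.qsat (tense_trans A) w (\<sigma>(x := d)) \<longleftrightarrow> rename (\<sigma>(x := d)) A \<in> fst w"
    if "d \<in> D" for d
  proof (rule IEx.IH)
    show "w \<in> worlds" by fact
    have "d \<in> Par" using that IEx.prems(1) w by (auto simp: worlds_def)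
    then show "range (\<sigma>(x := d)) \<subseteq> Par" using IEx.prems(2) by auto
    show "(\<sigma>(x := d)) ` ifv A \<subseteq> snd w" using fv that w by auto
  qed
  \<comment> \<open>A past domain need not contain the values of \<open>\<sigma>\<close>, so the induction hypothesis is used at \<open>w\<close>
    only, after moving the witness there by persistence.\<close>
  have "canonical.qsat (tense_trans (IEx x A)) w \<sigma> \<longleftrightarrow>
      (\<exists>d\<in>D. canonical.qsat (tense_trans A) (T, D) (\<sigma>(x := d)))" (is "?L \<longleftrightarrow> ?R")
  proof
    assume ?L
    then obtain v d where v: "fst v \<subseteq> T" "snd v \<subseteq> D" "d \<in> snd v"
      "canonical.qsat (tense_trans A) v (\<sigma>(x := d))"
      by (auto simp: w simp del: fun_upd_apply)
    then have "canonical.qsat (tense_trans A) (T, D) (\<sigma>(x := d))"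
      using IEx.prems(1) w by (intro canonical.qsat_persistent[OF v(4)]) auto
    then show ?R using v by blast
  next
    assume ?R
    then show ?L
      using IEx.prems(1) by (auto simp: w simp del: fun_upd_apply intro!: bexI[of _ "(T, D)"])
  qed
  then show ?case using IH by (simp add: iff w del: tense_trans.simps fun_upd_apply)
qed

lemma canonical_countermodel:
  assumes "A \<notin> IQC" "ifv A \<union> ibv A \<subseteq> Par"
  obtains w \<sigma> where "w \<in> worlds" "\<forall>x\<in>ifv A. \<sigma> x \<in> snd w"
    "\<not> canonical.qsat (tense_trans A) w \<sigma>"
proof -
  obtain p where "p \<in> Par"
    using infinite_Par by (metis all_not_in_conv finite.emptyI)
  \<comment> \<open>Variables outside \<open>Par\<close> get the default \<open>p\<close>, which
    keeps the range inside \<open>Par\<close>; the variables of \<open>A\<close> are fixed, as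
    \<open>der_rename\<close> requires.\<close>
  define \<sigma> where "\<sigma> x = (if x \<in> Par then x else p)" for x
  have \<sigma>: "range \<sigma> \<subseteq> Par" "\<And>x. x \<in> ifv A \<union> ibv A \<Longrightarrow> \<sigma> x = x"
    using assms(2) \<open>p \<in> Par\<close> by (auto simp: \<sigma>_def)
  have "\<not> der {} (rename \<sigma> A)"
    using assms(1) der_rename[OF assms(2) \<sigma>(2)] der_trans der_empty_iff by blast
  moreover have "ifv (rename \<sigma> A) \<subseteq> ifv A"
    using ifv_rename[of \<sigma> A] \<sigma>(2) by auto
  moreover have "infinite (Par - ifv A)"
    using infinite_Par by simp
  ultimately obtain T D where TD: "(T, D) \<in> worlds" "ifv A \<subseteq> D" "rename \<sigma> A \<notin> T"
    using worlds_extension[of "ifv A" "{}" "rename \<sigma> A"] assms(2) by (metis Un_subset_iff empty_iff)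
  show thesis
  proof (rule that)
    show "\<not> canonical.qsat (tense_trans A) (T, D) \<sigma>"
      using canonical_truth[OF TD(1) \<sigma>(1)] TD(2,3) \<sigma>(2) by fastforce
  qed (use TD \<sigma> in auto)
qed

end

lemma IQC_if_QAlls_tense_trans:
  assumes "QAlls xs (tense_trans A) \<in> QS4t" "set xs = ifv A"
  shows "A \<in> IQC"
proof (rule ccontr)
  assume "A \<notin> IQC"
  obtain N where N: "\<And>x. x \<in> ifv A \<union> ibv A \<Longrightarrow> x < N"
    using finite_nat_set_iff_bounded[of "ifv A \<union> ibv A"] by auto
  \<comment> \<open>All variables of \<open>A\<close> lie below \<open>N\<close> and become
    parameters. The even numbers make the set infinite, and the odd numbers beyond
    \<open>2 * N\<close> are left for bound names.\<close>
  define Par where "Par = {x. x < N \<or> even x}"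
  define bnd where "bnd n = 2 * (N + n) + 1" for n
  have "infinite (range (\<lambda>n::nat. 2 * n))"
    by (rule range_inj_infinite) (simp add: inj_def)
  moreover have "range (\<lambda>n. 2 * n) \<subseteq> Par"
    by (auto simp: Par_def)
  ultimately interpret parameters Par bnd
    by unfold_locales (auto simp: Par_def bnd_def inj_def dest: finite_subset)
  have vars: "ifv A \<union> ibv A \<subseteq> Par"
    using N by (auto simp: Par_def)
  obtain w \<sigma> where "w \<in> worlds" "\<forall>x\<in>ifv A. \<sigma> x \<in> snd w"
    "\<not> canonical.qsat (tense_trans A) w \<sigma>"
    by (rule canonical_countermodel[OF \<open>A \<notin> IQC\<close> vars])
  then show False
    using canonical.qsat_QAllsD[OF canonical.QS4t_sound[OF assms(1)]] assms(2) by blast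
qed

theorem mainTheorem1:
  shows "(\<forall>(A::ifm) (xs::var list). distinct xs \<and> set xs = ifv A \<longrightarrow>
            (A \<in> IQC \<longleftrightarrow> QAlls xs (tense_trans A) \<in> QS4t))
       \<and> (\<forall>A::ifm. ifv A = {} \<longrightarrow> (A \<in> IQC \<longleftrightarrow> tense_trans A \<in> QS4t))"
proof -
  have iff: "A \<in> IQC \<longleftrightarrow> QAlls xs (tense_trans A) \<in> QS4t" if "set xs = ifv A" for A xs
    using closed_provable_QAlls[OF closed_provable_tense_trans] IQC_if_QAlls_tense_trans that
    by (metis order_refl qfv_tense_trans)
  then show ?thesis
    using iff[of "[]"] by simp
qed

end
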